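(* Let $x_1,\ldots,x_n$ be self-adjoint elements in a von Neumann algebra $\mathcal{M}$ with a tracial state $\tau$. Let $\delta_0(x_1,\ldots,x_n)$ be Voiculescu's (modified) free entropy dimension. Then $$\delta_0(x_1,\ldots,x_n)\le \mathfrak{K}_1(x_1,\ldots,x_n)+1\le \mathfrak{K}_2(x_1,\ldots,x_n)+1 .$$
   Context: Tracial states are faithful and normal. Let $\mathcal{M}_k(\mathbb{C})$ be the $k\times k$ complex matrices, $\tau_k=\frac1k Tr$, $\mathcal{U}(k)$ the unitary group, and $\|(A_1,\ldots,A_n)\|_2^2=\sum_j\tau_k(A_j^*A_j)$ on $\mathcal{M}_k(\mathbb{C})^n$; $\|\cdot\|$ is the operator norm. For $R,\epsilon>0$ and $m,k\in\mathbb{N}$, $\Gamma_R(x_1,\ldots,x_n;m,k,\epsilon)$ is the set of $(A_1,\ldots,A_n)\in\mathcal{M}_k(\mathbb{C})^n$ with $\|A_j\|\le R$ for all $j$ and $|\tau_k(A_{i_1}^{\eta_1}\cdots A_{i_q}^{\eta_q})-\tau(x_{i_1}^{\eta_1}\cdots x_{i_q}^{\eta_q})|<\epsilon$ for all $1\le q\le m$, $1\le i_1,\ldots,i_q\le n$, $\eta_1,\ldots,\eta_q\in\{1,*\}$. For $\omega>0$, the $\omega$-orbit-ball $\mathcal{U}(B_1,\ldots,B_n;\omega)$ is the set of $(A_1,\ldots,A_n)\in\mathcal{M}_k(\mathbb{C})^n$ for which there is $W\in\mathcal{U}(k)$ with $\|(A_1,\ldots,A_n)-(WB_1W^*,\ldots,WB_nW^*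 )\|_2<\omega$. The $\omega$-orbit covering number $\nu(\Gamma_R(x_1,\ldots,x_n;m,k,\epsilon),\omega)$ is the minimal number of $\omega$-orbit-balls with centers in $\Gamma_R(x_1,\ldots,x_n;m,k,\epsilon)$ that cover this set (by convention $\nu(\emptyset,\omega)=1$, so that the quantities below are $\ge 0$ for $0<\omega<1$). Define $$\mathfrak{K}(x_1,\ldots,x_n;\omega,R)=\inf_{m\in\mathbb{N},\epsilon>0}\limsup_{k\to\infty}\frac{\log\nu(\Gamma_R(x_1,\ldots,x_n;m,k,\epsilon),\omega)}{-k^2\log\omega},$$ $\mathfrak{K}(x_1,\ldots,x_n;\omega)=\sup_{R>0}\mathfrak{K}(x_1,\ldots,x_n;\omega,R)$, $\mathfrak{K}_1(x_1,\ldots,x_n)=\limsup_{\omega\to0}\mathfrak{K}(x_1,\ldots,x_n;\omega)$, and $\mathfrak{K}_2(x_1,\ldots,x_n)=\sup_{0<\omega<1}\mathfrak{K}(x_1,\ldots,x_n;\omega)$. Free entropy dimension: for self-adjoint $x_1,\ldots,x_n$ and $y_1,\ldots,y_p$, let $\Gamma^{sa}_R(x_1,\ldots,x_n:y_1,\ldots,y_p;m,k,\epsilon)$ be the set of $n$-tuples of self-adjoint matrices in $\mathcal{M}_k(\mathbb{C})$ that can be completed by $p$ self-adjoint matrices to an $(n+p)$-tuple of matrices of operator norm $\le R$ whose mixed moments of order $\le m$ (with respect to $\tau_k$) are within $\epsilon$ of those of $(x_1,\ldots,x_n,y_1,\ldots,y_p)$; let $\chi(x_1,\ldots,x_n:y_1,\ldots,y_p)=\sup_R\inf_{m,\epsilon}\limsup_{k\to\infty}\left(k^{-2}\log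 \mathrm{vol}\,\Gamma^{sa}_R(x_1,\ldots,x_n:y_1,\ldots,y_p;m,k,\epsilon)+\frac n2\log k\right)$, with $\mathrm{vol}$ the Lebesgue measure associated with the Euclidean norm $(\sum_j Tr(A_j^2))^{1/2}$. Then $\delta_0(x_1,\ldots,x_n)=n+\limsup_{\epsilon\to0}\frac{\chi(x_1+\epsilon s_1,\ldots,x_n+\epsilon s_n:s_1,\ldots,s_n)}{|\log\epsilon|}$, where $\{s_1,\ldots,s_n\}$ is a free family of standard semicircular elements free from $\{x_1,\ldots,x_n\}$. *)

theory Defs
  imports
    "HOL-Analysis.Analysis"
    "Jordan_Normal_Form.Schur_Decomposition"
begin


section \<open>Tracial von Neumann algebras\<close>

text \<open>The inner product is linear in its first argument.\<close>

class complex_hilbert_space = banach +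
  fixes scaleC :: "complex \<Rightarrow> 'a \<Rightarrow> 'a"  (infixr "*\<^sub>C" 75)
    and cinner :: "'a \<Rightarrow> 'a \<Rightarrow> complex"
  assumes scaleC_add_right: "c *\<^sub>C (x + y) = c *\<^sub>C x + c *\<^sub>C y"
    and scaleC_add_left: "(c + d) *\<^sub>C x = c *\<^sub>C x + d *\<^sub>C x"
    and scaleC_scaleC: "c *\<^sub>C d *\<^sub>C x = (c * d) *\<^sub>C x"
    and scaleC_of_real: "complex_of_real r *\<^sub>C x = r *\<^sub>R x"
    and cinner_add_left: "cinner (x + y) z = cinner x z + cinner y z"
    and cinner_scaleC_left: "cinner (c *\<^sub>C x) y = c * cinner x y"
    and cinner_commute: "cinner x y = cnj (cinner y x)"
    and cinner_self: "cinner x x = complex_of_real ((norm x)\<^sup>2)"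

type_synonym 'h opr = "'h \<Rightarrow>\<^sub>L 'h"

text \<open>The type of bounded linear maps only records real linearity; the complex linear ones
  form \<open>B(H)\<close>.\<close>

definition bounded_operators :: "'h::complex_hilbert_space opr set" where
  "bounded_operators = {T. \<forall>c x. blinfun_apply T (c *\<^sub>C x) = c *\<^sub>C blinfun_apply T x}"

definition scale_op :: "complex \<Rightarrow> 'h::complex_hilbert_space opr \<Rightarrow> 'h opr" where
  "scale_op c T = Blinfun (\<lambda>x. c *\<^sub>C blinfun_apply T x)"

definition adj_op :: "'h::complex_hilbert_space opr \<Rightarrow> 'h opr" where
  "adj_op T = (THE S. \<forall>x y. cinner (blinfun_apply T x) y = cinner x (blinfun_apply S y))"

abbreviation selfadjoint :: "'h::complex_hilbert_space opr \<Rightarrow> bool" where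
  "selfadjoint T \<equiv> adj_op T = T"

definition op_le :: "'h::complex_hilbert_space opr \<Rightarrow> 'h opr \<Rightarrow> bool" where
  "op_le S T \<longleftrightarrow> (\<forall>x. cinner (blinfun_apply (T - S) x) x \<in> \<real>\<^sub>\<ge>\<^sub>0)"

definition commutant :: "'h::complex_hilbert_space opr set \<Rightarrow> 'h opr set" where
  "commutant X = {T \<in> bounded_operators. \<forall>S\<in>X. T o\<^sub>L S = S o\<^sub>L T}"

definition unital_star_subalgebra :: "'h::complex_hilbert_space opr set \<Rightarrow> bool" where
  "unital_star_subalgebra A \<longleftrightarrow>
     A \<subseteq> bounded_operators \<and> id_blinfun \<in> A \<and>
     (\<forall>S\<in>A. \<forall>T\<in>A. S + T \<in> A \<and> S o\<^sub>L T \<in> A) \<and>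
     (\<forall>T\<in>A. adj_op T \<in> A \<and> (\<forall>c. scale_op c T \<in> A))"

definition von_neumann_algebra :: "'h::complex_hilbert_space opr set \<Rightarrow> bool" where
  "von_neumann_algebra M \<longleftrightarrow> unital_star_subalgebra M \<and> commutant (commutant M) = M"

text \<open>Normality: a positive functional is normal if it preserves suprema of bounded upward
  directed families of self-adjoint elements (suprema taken in the self-adjoint part of the
  algebra).\<close>

definition is_sup_in :: "'h::complex_hilbert_space opr set \<Rightarrow> 'h opr set \<Rightarrow> 'h opr \<Rightarrow> bool" where
  "is_sup_in M D s \<longleftrightarrow>
     s \<in> M \<and> selfadjoint s \<and> (\<forall>d\<in>D. op_le d s) \<and>
     (\<forall>t\<in>M. selfadjoint t \<longrightarrow> (\<forall>d\<in>D. op_le d t) \<longrightarrow> op_le s t)"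

definition normal_functional :: "'h::complex_hilbert_space opr set \<Rightarrow> ('h opr \<Rightarrow> complex) \<Rightarrow> bool" where
  "normal_functional M \<tau> \<longleftrightarrow>
     (\<forall>D s. D \<noteq> {} \<longrightarrow> D \<subseteq> {d \<in> M. selfadjoint d} \<longrightarrow>
        (\<forall>a\<in>D. \<forall>b\<in>D. \<exists>c\<in>D. op_le a c \<and> op_le b c) \<longrightarrow> is_sup_in M D s \<longrightarrow>
        Re (\<tau> s) = (SUP d\<in>D. Re (\<tau> d)))"

definition faithful_normal_tracial_state ::
    "'h::complex_hilbert_space opr set \<Rightarrow> ('h opr \<Rightarrow> complex) \<Rightarrow> bool" where
  "faithful_normal_tracial_state M \<tau> \<longleftrightarrow>
     (\<forall>S\<in>M. \<forall>T\<in>M. \<tau> (S + T) = \<tau> S + \<tau> T) \<and>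
     (\<forall>c. \<forall>T\<in>M. \<tau> (scale_op c T) = c * \<tau> T) \<and>
     (\<forall>T\<in>M. \<tau> (adj_op T o\<^sub>L T) \<in> \<real>\<^sub>\<ge>\<^sub>0) \<and>
     \<tau> id_blinfun = 1 \<and>
     (\<forall>S\<in>M. \<forall>T\<in>M. \<tau> (S o\<^sub>L T) = \<tau> (T o\<^sub>L S)) \<and>
     (\<forall>T\<in>M. \<tau> (adj_op T o\<^sub>L T) = 0 \<longrightarrow> T = 0) \<and>
     normal_functional M \<tau>"

definition tracial_von_neumann_algebra ::
    "'h::complex_hilbert_space opr set \<Rightarrow> ('h opr \<Rightarrow> complex) \<Rightarrow> bool" where
  "tracial_von_neumann_algebra M \<tau> \<longleftrightarrow>
     von_neumann_algebra M \<and> faithful_normal_tracial_state M \<tau>"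

definition trace_preserving_embedding ::
    "'h::complex_hilbert_space opr set \<Rightarrow> ('h opr \<Rightarrow> complex) \<Rightarrow>
     'g::complex_hilbert_space opr set \<Rightarrow> ('g opr \<Rightarrow> complex) \<Rightarrow> ('h opr \<Rightarrow> 'g opr) \<Rightarrow> bool" where
  "trace_preserving_embedding M \<tau> N \<sigma> \<pi> \<longleftrightarrow>
     \<pi> ` M \<subseteq> N \<and> \<pi> id_blinfun = id_blinfun \<and>
     (\<forall>S\<in>M. \<forall>T\<in>M. \<pi> (S + T) = \<pi> S + \<pi> T \<and> \<pi> (S o\<^sub>L T) = \<pi> S o\<^sub>L \<pi> T) \<and>
     (\<forall>T\<in>M. \<pi> (adj_op T) = adj_op (\<pi> T) \<and> (\<forall>c. \<pi> (scale_op c T) = scale_op c (\<pi> T)) \<and>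
            \<sigma> (\<pi> T) = \<tau> T)"


section \<open>Freeness and semicircular elements\<close>

definition generated_algebra :: "'h::complex_hilbert_space opr set \<Rightarrow> 'h opr set" where
  "generated_algebra X = \<Inter>{A. unital_star_subalgebra A \<and> X \<subseteq> A}"

definition op_prod :: "'h::complex_hilbert_space opr list \<Rightarrow> 'h opr" where
  "op_prod Ts = foldr (o\<^sub>L) Ts id_blinfun"

definition free_sets ::
    "('h::complex_hilbert_space opr \<Rightarrow> complex) \<Rightarrow> 'i set \<Rightarrow> ('i \<Rightarrow> 'h opr set) \<Rightarrow> bool" where
  "free_sets \<tau> I X \<longleftrightarrow>
     (\<forall>is as. is \<noteq> [] \<longrightarrow> length as = length is \<longrightarrow> set is \<subseteq> I \<longrightarrow> distinct_adj is \<longrightarrow>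
        (\<forall>j<length is. as ! j \<in> generated_algebra (X (is ! j)) \<and> \<tau> (as ! j) = 0) \<longrightarrow>
        \<tau> (op_prod as) = 0)"

definition standard_semicircular ::
    "('h::complex_hilbert_space opr \<Rightarrow> complex) \<Rightarrow> 'h opr \<Rightarrow> bool" where
  "standard_semicircular \<tau> s \<longleftrightarrow> selfadjoint s \<and>
     (\<forall>p. \<tau> (op_prod (replicate p s)) =
        complex_of_real (integral {-2..2} (\<lambda>t. t ^ p * (sqrt (4 - t\<^sup>2) / (2 * pi)))))"

definition free_semicircular_family_free_from ::
    "('h::complex_hilbert_space opr \<Rightarrow> complex) \<Rightarrow> 'h opr list \<Rightarrow> 'h opr list \<Rightarrow> bool" where
  "free_semicircular_family_free_from \<tau> ss xs \<longleftrightarrow>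
     (\<forall>s\<in>set ss. standard_semicircular \<tau> s) \<and>
     free_sets \<tau> {..<length ss} (\<lambda>j. {ss ! j}) \<and>
     free_sets \<tau> (UNIV :: bool set) (\<lambda>b. if b then set ss else set xs)"


section \<open>Matrices\<close>

definition ntr :: "complex mat \<Rightarrow> complex" where
  "ntr A = (\<Sum>i<dim_row A. A $$ (i, i)) / of_nat (dim_row A)"

definition cvec_norm :: "complex vec \<Rightarrow> real" where
  "cvec_norm v = sqrt (Re (v \<bullet>c v))"

definition mat_op_norm :: "complex mat \<Rightarrow> real" where
  "mat_op_norm A =
     (SUP v\<in>{v \<in> carrier_vec (dim_col A). cvec_norm v \<le> 1}. cvec_norm (A *\<^sub>v v))"

definition tuple_norm2 :: "complex mat list \<Rightarrow> real" where
  "tuple_norm2 As = sqrt (\<Sum>A\<leftarrow>As. Re (ntr (mat_adjoint A * A)))"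

definition unitary_group :: "nat \<Rightarrow> complex mat set" where
  "unitary_group k =
     {W \<in> carrier_mat k k. mat_adjoint W * W = 1\<^sub>m k \<and> W * mat_adjoint W = 1\<^sub>m k}"

definition mat_tuples :: "nat \<Rightarrow> nat \<Rightarrow> complex mat list set" where
  "mat_tuples n k = {As. length As = n \<and> set As \<subseteq> carrier_mat k k}"


section \<open>Microstates and orbit covering numbers\<close>

text \<open>A letter \<open>(i, b)\<close> of a word stands for the \<open>i\<close>-th entry of a tuple (counted from 0),
  with a star if \<open>b\<close> holds.\<close>

definition mat_word :: "nat \<Rightarrow> complex mat list \<Rightarrow> (nat \<times> bool) list \<Rightarrow> complex mat" where
  "mat_word k As w =
     foldr (\<lambda>(i, b) B. (if b then mat_adjoint (As ! i) else As ! i) * B) w (1\<^sub>m k)"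

definition op_word :: "'h::complex_hilbert_space opr list \<Rightarrow> (nat \<times> bool) list \<Rightarrow> 'h opr" where
  "op_word xs w = op_prod (map (\<lambda>(i, b). if b then adj_op (xs ! i) else xs ! i) w)"

definition microstates ::
    "('h::complex_hilbert_space opr \<Rightarrow> complex) \<Rightarrow> 'h opr list \<Rightarrow> real \<Rightarrow> nat \<Rightarrow> nat \<Rightarrow> real
       \<Rightarrow> complex mat list set" where
  "microstates \<tau> xs R m k \<epsilon> =
     {As \<in> mat_tuples (length xs) k.
        (\<forall>A\<in>set As. mat_op_norm A \<le> R) \<and>
        (\<forall>w. 1 \<le> length w \<longrightarrow> length w \<le> m \<longrightarrow> fst ` set w \<subseteq> {..<length xs} \<longrightarrow>
           cmod (ntr (mat_word k As w) - \<tau> (op_word xs w)) < \<epsilon>)}"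

definition orbit_ball :: "nat \<Rightarrow> real \<Rightarrow> complex mat list \<Rightarrow> complex mat list set" where
  "orbit_ball k \<omega> Bs =
     {As \<in> mat_tuples (length Bs) k. \<exists>W\<in>unitary_group k.
        tuple_norm2 (map2 (\<lambda>A B. A - W * B * mat_adjoint W) As Bs) < \<omega>}"

definition orbit_covering_number :: "nat \<Rightarrow> complex mat list set \<Rightarrow> real \<Rightarrow> ennreal" where
  "orbit_covering_number k \<Gamma> \<omega> =
     (if \<Gamma> = {} then 1
      else (INF F\<in>{F. finite F \<and> F \<subseteq> \<Gamma> \<and> \<Gamma> \<subseteq> (\<Union>Bs\<in>F. orbit_ball k \<omega> Bs)}. of_nat (card F)))"

definition eln :: "ennreal \<Rightarrow> ereal" where
  "eln x = (if x = 0 then -\<infinity> else if x = \<infinity> then \<infinity> else ereal (ln (enn2real x)))"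

definition orbit_dim_cutoff ::
    "('h::complex_hilbert_space opr \<Rightarrow> complex) \<Rightarrow> 'h opr list \<Rightarrow> real \<Rightarrow> real \<Rightarrow> ereal" where
  "orbit_dim_cutoff \<tau> xs \<omega> R =
     (INF (m, \<epsilon>)\<in>UNIV \<times> {0<..}. limsup (\<lambda>k.
        eln (orbit_covering_number k (microstates \<tau> xs R m k \<epsilon>) \<omega>) / ereal (- (real k)\<^sup>2 * ln \<omega>)))"

definition orbit_dim_at ::
    "('h::complex_hilbert_space opr \<Rightarrow> complex) \<Rightarrow> 'h opr list \<Rightarrow> real \<Rightarrow> ereal" where
  "orbit_dim_at \<tau> xs \<omega> = (SUP R\<in>{0<..}. orbit_dim_cutoff \<tau> xs \<omega> R)"

definition orbit_dim1 ::
    "('h::complex_hilbert_space opr \<Rightarrow> complex) \<Rightarrow> 'h opr list \<Rightarrow> ereal" where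
  "orbit_dim1 \<tau> xs = Limsup (at_right 0) (\<lambda>\<omega>. orbit_dim_at \<tau> xs \<omega>)"

definition orbit_dim2 ::
    "('h::complex_hilbert_space opr \<Rightarrow> complex) \<Rightarrow> 'h opr list \<Rightarrow> ereal" where
  "orbit_dim2 \<tau> xs = (SUP \<omega>\<in>{0<..<1}. orbit_dim_at \<tau> xs \<omega>)"


section \<open>Free entropy dimension\<close>

definition sa_microstates ::
    "('h::complex_hilbert_space opr \<Rightarrow> complex) \<Rightarrow> 'h opr list \<Rightarrow> 'h opr list
       \<Rightarrow> real \<Rightarrow> nat \<Rightarrow> nat \<Rightarrow> real \<Rightarrow> complex mat list set" where
  "sa_microstates \<tau> xs ys R m k \<epsilon> =
     {As \<in> mat_tuples (length xs) k. \<exists>Bs\<in>mat_tuples (length ys) k.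
        (\<forall>A\<in>set (As @ Bs). mat_adjoint A = A \<and> mat_op_norm A \<le> R) \<and>
        (\<forall>w. 1 \<le> length w \<longrightarrow> length w \<le> m \<longrightarrow> set w \<subseteq> {..<length (xs @ ys)} \<longrightarrow>
           cmod (ntr (foldr (*) (map ((!) (As @ Bs)) w) (1\<^sub>m k))
                 - \<tau> (op_prod (map ((!) (xs @ ys)) w))) < \<epsilon>)}"

text \<open>Coordinates of an \<open>n\<close>-tuple of self-adjoint \<open>k \<times> k\<close> matrices with respect to an orthonormal
  basis for \<open>\<langle>A, B\<rangle> = (\<Sum>l<n. Tr (A\<^sub>l B\<^sub>l))\<close>: the diagonal entries are coordinates themselves, while
  an off-diagonal entry occurs twice in \<open>Tr (A\<^sub>l\<^sup>2)\<close>, whence the factor \<open>1 / sqrt 2\<close>. So the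
  associated Lebesgue measure is the product Lebesgue measure in these coordinates.\<close>

definition sa_tuple_of_coords :: "nat \<Rightarrow> nat \<Rightarrow> (nat \<times> nat \<times> nat \<Rightarrow> real) \<Rightarrow> complex mat list" where
  "sa_tuple_of_coords n k t =
     map (\<lambda>l. Matrix.mat k k (\<lambda>(i, j).
            if i = j then complex_of_real (t (l, i, i))
            else if i < j then Complex (t (l, i, j)) (t (l, j, i)) / complex_of_real (sqrt 2)
            else Complex (t (l, j, i)) (- t (l, i, j)) / complex_of_real (sqrt 2)))
       [0..<n]"

definition sa_volume :: "nat \<Rightarrow> nat \<Rightarrow> complex mat list set \<Rightarrow> ennreal" where
  "sa_volume n k X =
     (let L = Pi\<^sub>M ({..<n} \<times> {..<k} \<times> {..<k}) (\<lambda>_. lborel :: real measure)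
      in emeasure L {t \<in> space L. sa_tuple_of_coords n k t \<in> X})"

definition free_entropy ::
    "('h::complex_hilbert_space opr \<Rightarrow> complex) \<Rightarrow> 'h opr list \<Rightarrow> 'h opr list \<Rightarrow> ereal" where
  "free_entropy \<tau> xs ys =
     (SUP R\<in>{0<..}. INF (m, \<epsilon>)\<in>UNIV \<times> {0<..}. limsup (\<lambda>k.
        eln (sa_volume (length xs) k (sa_microstates \<tau> xs ys R m k \<epsilon>)) / ereal ((real k)\<^sup>2)
        + ereal (real (length xs) / 2 * ln (real k))))"

text \<open>The elements \<open>ss\<close> are meant to be a free family of standard semicircular elements free from
  \<open>xs\<close>; the value only depends on the joint moments of \<open>xs\<close> and \<open>ss\<close>, and hence not on the choice
  of \<open>ss\<close> or of the algebra in which they live.\<close>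

definition free_entropy_dim ::
    "('h::complex_hilbert_space opr \<Rightarrow> complex) \<Rightarrow> 'h opr list \<Rightarrow> 'h opr list \<Rightarrow> ereal" where
  "free_entropy_dim \<tau> xs ss =
     ereal (real (length xs)) +
     Limsup (at_right 0) (\<lambda>\<epsilon>.
       free_entropy \<tau> (map2 (\<lambda>x s. x + \<epsilon> *\<^sub>R s) xs ss) ss / ereal \<bar>ln \<epsilon>\<bar>)"

end

theory Submission
  imports Defs "HOL-Probability.Distributions"
begin

text \<open>If $(A, B)$ is a microstate of $(x + \epsilon s, s)$, then $A - \epsilon B$ is a microstate of
  $x$ at $\|\cdot\|_2$-distance $O(\epsilon)$ from $A$. Hence an optimal cover of the microstates of
  $x$ by $\epsilon$-orbit-balls places $A$ within $O(\epsilon)$ of the unitary orbit of one of $\nu$ centres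
  $D$. As the $k^2$-dimensional group of unitaries has an $\epsilon$-net of cardinality
  $(C/\epsilon)^{k^2}$ in operator norm, the microstates of $x + \epsilon s$ lie in
  $\nu (C/\epsilon)^{k^2}$ Euclidean balls of radius $O(\epsilon \sqrt k)$ in dimension $n k^2$. Comparing
  volumes, $\chi \le |\log\epsilon| (1 - n + \mathfrak{K}(x; \epsilon)) + O(1)$, where the error does not
  depend on $\epsilon$ or $R$.\<close>


text \<open>The exponent of the unitary net decides the result: k^2 yields the summand 1, whereas
  packing the unitaries inside all complex matrices, a space of real dimension 2 k^2, would yield 2.
  The skew-adjoint part offers k^2 coordinates, but it determines a unitary only near the identity.
  So the group is covered at a fixed scale, where the doubled dimension costs only a constant to the
  power k^2, and each piece is refined after translation to the identity. A constant growing with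
  the cutoff R would be fatal, because \<open>free_entropy\<close> takes a supremum over R for fixed
  \<epsilon>. Euclidean lengths are therefore bounded through second moments, which are
  approximately prescribed, and not through operator norms. The cutoff itself becomes 2 R in passing
  from A to A - \<epsilon> B, and the supremum in \<open>orbit_dim_at\<close> absorbs this. A ball
  of radius O(\<epsilon> sqrt k) in dimension n k^2 has volume at most (O(\<epsilon>) / sqrt k)^(n
  k^2); the power of k in it cancels the term (n / 2) log k in the definition of free
  entropy.\<close>

section \<open>Matrix norms\<close>

lemma adjoint_carrier [simp, intro]: "A \<in> carrier_mat n m \<Longrightarrow> mat_adjoint A \<in> carrier_mat m n"
  unfolding mat_adjoint_def carrier_mat_def by auto

lemma dim_adjoint [simp]: "dim_row (mat_adjoint A) = dim_col A" "dim_col (mat_adjoint A) = dim_row A"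
  unfolding mat_adjoint_def by auto

lemma index_adjoint [simp]:
  fixes A :: "complex mat"
  shows "i < dim_col A \<Longrightarrow> j < dim_row A \<Longrightarrow> mat_adjoint A $$ (i, j) = cnj (A $$ (j, i))"
  unfolding mat_adjoint_def by (auto simp: mat_of_rows_index)

lemma adjoint_adjoint [simp]: "mat_adjoint (mat_adjoint A) = (A :: complex mat)"
  by (rule eq_matI) auto

lemma adjoint_minus:
  fixes A :: "complex mat"
  shows "A \<in> carrier_mat n m \<Longrightarrow> B \<in> carrier_mat n m \<Longrightarrow> mat_adjoint (A - B) = mat_adjoint A - mat_adjoint B"
  by (rule eq_matI) auto

lemma adjoint_mult:
  fixes A :: "complex mat"
  assumes "A \<in> carrier_mat n m" "B \<in> carrier_mat m l"
  shows "mat_adjoint (A * B) = mat_adjoint B * mat_adjoint A"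
  by (rule eq_matI) (use assms in \<open>auto simp: scalar_prod_def mult.commute intro!: sum.cong\<close>)

lemma adjoint_one [simp]: "mat_adjoint (1\<^sub>m k :: complex mat) = 1\<^sub>m k"
  by (rule eq_matI) auto

lemma adjoint_scalar_prod:
  fixes A :: "complex mat"
  assumes "A \<in> carrier_mat n m" "v \<in> carrier_vec m" "w \<in> carrier_vec n"
  shows "(A *\<^sub>v v) \<bullet>c w = v \<bullet>c (mat_adjoint A *\<^sub>v w)"
proof -
  have "(A *\<^sub>v v) \<bullet>c w = (\<Sum>i<n. \<Sum>j<m. A $$ (i, j) * v $ j * cnj (w $ i))"
    using assms by (simp add: scalar_prod_def sum_distrib_right atLeast0LessThan)
  also have "\<dots> = (\<Sum>j<m. \<Sum>i<n. A $$ (i, j) * v $ j * cnj (w $ i))"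
    by (rule sum.swap)
  also have "\<dots> = v \<bullet>c (mat_adjoint A *\<^sub>v w)"
    using assms by (simp add: scalar_prod_def sum_distrib_left atLeast0LessThan algebra_simps)
  finally show ?thesis .
qed

section \<open>Euclidean norm of vectors and operator norm of matrices\<close>

lemma scalar_prod_self: "v \<bullet>c v = complex_of_real ((L2_set (\<lambda>i. cmod (v $ i)) {..<dim_vec v})\<^sup>2)"
  by (simp add: scalar_prod_def L2_set_def sum_nonneg atLeast0LessThan complex_norm_square[symmetric])
 
lemma cvec_norm_L2: "cvec_norm v = L2_set (\<lambda>i. cmod (v $ i)) {..<dim_vec v}"
  unfolding cvec_norm_def scalar_prod_self by simp

lemma cvec_norm_nonneg [simp]: "0 \<le> cvec_norm v"
  unfolding cvec_norm_L2 by simp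

lemma cvec_norm_triangle:
  assumes "v \<in> carrier_vec n" "w \<in> carrier_vec n"
  shows "cvec_norm (v + w) \<le> cvec_norm v + cvec_norm w"
proof -
  have "cvec_norm (v + w) \<le> L2_set (\<lambda>i. cmod (v $ i) + cmod (w $ i)) {..<n}"
    unfolding cvec_norm_L2 using assms by (auto intro!: L2_set_mono norm_triangle_ineq)
  also have "\<dots> \<le> cvec_norm v + cvec_norm w"
    unfolding cvec_norm_L2 using assms L2_set_triangle_ineq by auto
  finally show ?thesis .
qed

lemma cvec_norm_smult: "cvec_norm (c \<cdot>\<^sub>v v) = cmod c * cvec_norm v"
  unfolding cvec_norm_L2 L2_set_right_distrib[OF norm_ge_zero]
  by (rule L2_set_cong) (auto simp: norm_mult)

lemma cvec_norm_zero_iff: "v \<in> carrier_vec n \<Longrightarrow> cvec_norm v = 0 \<longleftrightarrow> v = 0\<^sub>v n"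
  unfolding cvec_norm_L2 by (subst L2_set_eq_0_iff) auto

lemma cvec_norm_unit [simp]: "j < n \<Longrightarrow> cvec_norm (unit_vec n j) = 1"
  unfolding cvec_norm_def by simp

lemma scalar_prod_le_cvec_norm:
  assumes "v \<in> carrier_vec n" "w \<in> carrier_vec n"
  shows "cmod (v \<bullet>c w) \<le> cvec_norm v * cvec_norm w"
proof -
  have "cmod (v \<bullet>c w) \<le> (\<Sum>i<n. cmod (v $ i) * cmod (w $ i))"
    using assms by (auto simp: scalar_prod_def atLeast0LessThan norm_mult intro!: sum_norm_le)
  also have "\<dots> \<le> cvec_norm v * cvec_norm w"
    unfolding cvec_norm_L2 using assms L2_set_mult_ineq[of "\<lambda>i. cmod (v $ i)" "\<lambda>i. cmod (w $ i)"] by simp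
  finally show ?thesis .
qed

text \<open>A crude upper bound for the operator norm. Its finiteness makes the real supremum in
  \<open>mat_op_norm\<close> meaningful, and later it shows that matrices with small coordinates
  have small norm.\<close>

definition entry_sum :: "complex mat \<Rightarrow> real" where
  "entry_sum A = (\<Sum>i<dim_row A. \<Sum>j<dim_col A. cmod (A $$ (i, j)))"

lemma cvec_norm_le_sum: "cvec_norm v \<le> (\<Sum>i<dim_vec v. cmod (v $ i))"
  unfolding cvec_norm_L2 using L2_set_le_sum_abs[of "\<lambda>i. cmod (v $ i)"] by simp

lemma cvec_norm_component: "i < dim_vec v \<Longrightarrow> cmod (v $ i) \<le> cvec_norm v"
  unfolding cvec_norm_L2 by (rule member_le_L2_set) auto

lemma cvec_norm_mult_le_entry_sum:
  assumes "v \<in> carrier_vec (dim_col A)"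
  shows "cvec_norm (A *\<^sub>v v) \<le> entry_sum A * cvec_norm v"
proof -
  have "cvec_norm (A *\<^sub>v v) \<le> (\<Sum>i<dim_row A. cmod ((A *\<^sub>v v) $ i))"
    using cvec_norm_le_sum[of "A *\<^sub>v v"] by simp
  also have "\<dots> \<le> (\<Sum>i<dim_row A. \<Sum>j<dim_col A. cmod (A $$ (i, j)) * cvec_norm v)"
    using assms
    by (auto simp: scalar_prod_def atLeast0LessThan norm_mult
        intro!: sum_mono sum_norm_le mult_left_mono cvec_norm_component)
  also have "\<dots> = entry_sum A * cvec_norm v"
    by (simp add: entry_sum_def sum_distrib_right)
  finally show ?thesis .
qed

lemma mat_op_norm_le:
  assumes "\<And>v. v \<in> carrier_vec (dim_col A) \<Longrightarrow> cvec_norm (A *\<^sub>v v) \<le> c * cvec_norm v" "0 \<le> c"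
  shows "mat_op_norm A \<le> c"
  unfolding mat_op_norm_def
proof (rule cSUP_least)
  show "{v \<in> carrier_vec (dim_col A). cvec_norm v \<le> 1} \<noteq> {}"
    by (auto intro!: exI[of _ "0\<^sub>v (dim_col A)"] simp: cvec_norm_L2 L2_set_def)
next
  fix v :: "complex vec" assume "v \<in> {v \<in> carrier_vec (dim_col A). cvec_norm v \<le> 1}"
  then show "cvec_norm (A *\<^sub>v v) \<le> c"
    using assms(1)[of v] mult_left_mono[of "cvec_norm v" 1 c] assms(2) by auto
qed

lemma bdd_above_op_norm:
  "bdd_above ((\<lambda>v. cvec_norm (A *\<^sub>v v)) ` {v \<in> carrier_vec (dim_col A). cvec_norm v \<le> 1})"
proof (rule bdd_aboveI2)
  fix v :: "complex vec" assume v: "v \<in> {v \<in> carrier_vec (dim_col A). cvec_norm v \<le> 1}"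
  have "0 \<le> entry_sum A" by (simp add: entry_sum_def sum_nonneg)
  then show "cvec_norm (A *\<^sub>v v) \<le> entry_sum A"
    using v cvec_norm_mult_le_entry_sum[of v A] mult_left_mono[of "cvec_norm v" 1 "entry_sum A"] by auto
qed

lemma cvec_norm_mult_le:
  assumes "A \<in> carrier_mat n m" "v \<in> carrier_vec m"
  shows "cvec_norm (A *\<^sub>v v) \<le> mat_op_norm A * cvec_norm v"
proof (cases "cvec_norm v = 0")
  case True
  then have "v = 0\<^sub>v m" using assms cvec_norm_zero_iff by blast
  then have "A *\<^sub>v v = 0\<^sub>v n" using assms by auto
  then show ?thesis using True by (simp add: cvec_norm_L2 L2_set_def)
next
  case False
  define r where "r = cvec_norm v"
  have r: "r > 0" using False by (simp add: r_def order.strict_iff_order)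
  define w where "w = complex_of_real (1 / r) \<cdot>\<^sub>v v"
  have w: "w \<in> carrier_vec m" "cvec_norm w = 1" 
    using assms r unfolding w_def cvec_norm_smult by (auto simp: norm_divide r_def)
  have "cvec_norm (A *\<^sub>v w) \<le> mat_op_norm A" unfolding mat_op_norm_def
    by (rule cSUP_upper[OF _ bdd_above_op_norm]) (use w assms in auto)
  moreover have "A *\<^sub>v w = complex_of_real (1 / r) \<cdot>\<^sub>v (A *\<^sub>v v)"
    unfolding w_def using assms by (simp add: mult_mat_vec)
  ultimately have "cvec_norm (A *\<^sub>v v) / r \<le> mat_op_norm A"
    using r by (simp add: cvec_norm_smult norm_divide)
  then show ?thesis using r by (simp add: r_def field_simps)
qed

lemma mat_op_norm_nonneg [simp]: "0 \<le> mat_op_norm A"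
proof -
  have "cvec_norm (A *\<^sub>v 0\<^sub>v (dim_col A)) \<le> mat_op_norm A" unfolding mat_op_norm_def
    by (rule cSUP_upper[OF _ bdd_above_op_norm]) (auto simp: cvec_norm_L2 L2_set_def)
  then show ?thesis using cvec_norm_nonneg order_trans by blast
qed

lemma mat_op_norm_triangle:
  assumes "A \<in> carrier_mat n m" "B \<in> carrier_mat n m"
  shows "mat_op_norm (A + B) \<le> mat_op_norm A + mat_op_norm B"
proof (rule mat_op_norm_le)
  fix v :: "complex vec" assume "v \<in> carrier_vec (dim_col (A + B))"
  then have v: "v \<in> carrier_vec m" using assms by simp
  have "cvec_norm ((A + B) *\<^sub>v v) = cvec_norm (A *\<^sub>v v + B *\<^sub>v v)"
    using assms v by (simp add: add_mult_distrib_mat_vec)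
  also have "\<dots> \<le> cvec_norm (A *\<^sub>v v) + cvec_norm (B *\<^sub>v v)"
    using assms v by (intro cvec_norm_triangle[of _ n]) auto
  also have "\<dots> \<le> (mat_op_norm A + mat_op_norm B) * cvec_norm v"
    using cvec_norm_mult_le[OF assms(1) v] cvec_norm_mult_le[OF assms(2) v] by (simp add: distrib_right)
  finally show "cvec_norm ((A + B) *\<^sub>v v) \<le> (mat_op_norm A + mat_op_norm B) * cvec_norm v" .
qed simp

lemma mat_op_norm_mult:
  assumes "A \<in> carrier_mat n m" "B \<in> carrier_mat m l"
  shows "mat_op_norm (A * B) \<le> mat_op_norm A * mat_op_norm B"
proof (rule mat_op_norm_le)
  fix v :: "complex vec" assume "v \<in> carrier_vec (dim_col (A * B))"
  then have v: "v \<in> carrier_vec l" using assms by simp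
  have "cvec_norm ((A * B) *\<^sub>v v) = cvec_norm (A *\<^sub>v (B *\<^sub>v v))"
    using assms v by simp
  also have "\<dots> \<le> mat_op_norm A * cvec_norm (B *\<^sub>v v)"
    using assms v by (intro cvec_norm_mult_le) auto
  also have "\<dots> \<le> mat_op_norm A * (mat_op_norm B * cvec_norm v)"
    using assms v by (intro mult_left_mono cvec_norm_mult_le) auto
  finally show "cvec_norm ((A * B) *\<^sub>v v) \<le> mat_op_norm A * mat_op_norm B * cvec_norm v" by (simp add: mult.assoc)
qed simp

lemma mat_op_norm_smult: "mat_op_norm (c \<cdot>\<^sub>m A) \<le> cmod c * mat_op_norm A"
proof (rule mat_op_norm_le)
  fix v :: "complex vec" assume "v \<in> carrier_vec (dim_col (c \<cdot>\<^sub>m A))"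
  then have v: "v \<in> carrier_vec (dim_col A)" by simp
  have "(c \<cdot>\<^sub>m A) *\<^sub>v v = c \<cdot>\<^sub>v (A *\<^sub>v v)" using v by (intro eq_vecI) auto
  then show "cvec_norm ((c \<cdot>\<^sub>m A) *\<^sub>v v) \<le> cmod c * mat_op_norm A * cvec_norm v"
    using cvec_norm_mult_le[of A "dim_row A" "dim_col A" v] v
    by (auto simp: cvec_norm_smult mult.assoc intro!: mult_left_mono)
qed simp

text \<open>With w = A* v one has |w|^2 = <A w, v> \<le> ||A|| |w| |v|, and |w| can be
  cancelled.\<close>

lemma mat_op_norm_adjoint_le:
  assumes "A \<in> carrier_mat n m"
  shows "mat_op_norm (mat_adjoint A) \<le> mat_op_norm A"
proof (rule mat_op_norm_le)
  fix v :: "complex vec" assume "v \<in> carrier_vec (dim_col (mat_adjoint A))"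
  then have v: "v \<in> carrier_vec n" using assms by simp
  define w where "w = mat_adjoint A *\<^sub>v v"
  have w: "w \<in> carrier_vec m" using adjoint_carrier[OF assms] v by (simp add: w_def)
  have "(cvec_norm w)\<^sup>2 = cmod (w \<bullet>c w)"
    unfolding scalar_prod_self cvec_norm_L2 by (simp add: norm_power)
  also have "\<dots> = cmod ((A *\<^sub>v w) \<bullet>c v)"
    using adjoint_scalar_prod[OF assms w v] by (simp add: w_def)
  also have "\<dots> \<le> cvec_norm (A *\<^sub>v w) * cvec_norm v"
    using assms w v by (intro scalar_prod_le_cvec_norm[of _ n]) auto
  also have "\<dots> \<le> mat_op_norm A * cvec_norm w * cvec_norm v"
    using assms w by (intro mult_right_mono cvec_norm_mult_le) auto
  finally have "cvec_norm w * cvec_norm w \<le> cvec_norm w * (mat_op_norm A * cvec_norm v)"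
    by (simp add: power2_eq_square mult_ac)
  then have "cvec_norm w \<le> mat_op_norm A * cvec_norm v"
    by (cases "cvec_norm w = 0") (auto simp: mult_le_cancel_left order.strict_iff_order)
  then show "cvec_norm (mat_adjoint A *\<^sub>v v) \<le> mat_op_norm A * cvec_norm v" by (simp add: w_def)
qed simp

lemma mat_op_norm_adjoint: "A \<in> carrier_mat n m \<Longrightarrow> mat_op_norm (mat_adjoint A) = mat_op_norm A"
  using mat_op_norm_adjoint_le[of A n m] mat_op_norm_adjoint_le[of "mat_adjoint A" m n] by auto

lemma index_le_mat_op_norm:
  assumes "A \<in> carrier_mat n m" "i < n" "j < m"
  shows "cmod (A $$ (i, j)) \<le> mat_op_norm A"
proof -
  have "cmod (A $$ (i, j)) = cmod ((A *\<^sub>v unit_vec m j) $ i)"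
    using assms by simp
  also have "\<dots> \<le> cvec_norm (A *\<^sub>v unit_vec m j)"
    using assms by (intro cvec_norm_component) auto
  also have "\<dots> \<le> mat_op_norm A"
    using cvec_norm_mult_le[OF assms(1), of "unit_vec m j"] assms by simp
  finally show ?thesis .
qed

lemma mat_op_norm_le_entry_sum: "mat_op_norm A \<le> entry_sum A"
  by (rule mat_op_norm_le[OF cvec_norm_mult_le_entry_sum]) (auto simp: entry_sum_def intro!: sum_nonneg)

section \<open>Unitary matrices and their products\<close>

lemma unitary_group_carrier: "W \<in> unitary_group k \<Longrightarrow> W \<in> carrier_mat k k"
  by (simp add: unitary_group_def)

text \<open>W preserves the inner product. Only an inequality is claimed, since for k = 0 the norm
  is 0.\<close>

lemma mat_op_norm_unitary:
  assumes "W \<in> unitary_group k"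
  shows "mat_op_norm W \<le> 1"
proof (rule mat_op_norm_le)
  fix v :: "complex vec" assume "v \<in> carrier_vec (dim_col W)"
  have W: "W \<in> carrier_mat k k" "mat_adjoint W * W = 1\<^sub>m k" using assms by (auto simp: unitary_group_def)
  with \<open>v \<in> _\<close> have v: "v \<in> carrier_vec k" by simp
  have "mat_adjoint W *\<^sub>v (W *\<^sub>v v) = v"
    using W v by (metis adjoint_carrier assoc_mult_mat_vec one_mult_mat_vec)
  then have "(W *\<^sub>v v) \<bullet>c (W *\<^sub>v v) = v \<bullet>c v"
    using adjoint_scalar_prod[OF W(1) v, of "W *\<^sub>v v"] W v by auto
  then show "cvec_norm (W *\<^sub>v v) \<le> 1 * cvec_norm v" by (simp add: cvec_norm_def)
qed simp

lemma unitary_group_adjoint: "W \<in> unitary_group k \<Longrightarrow> mat_adjoint W \<in> unitary_group k"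
  by (auto simp: unitary_group_def)

lemma unitary_group_mult:
  assumes "V \<in> unitary_group k" "W \<in> unitary_group k"
  shows "V * W \<in> unitary_group k"
proof -
  \<comment> \<open>One computation serves both identities: it is applied to V, W and then to W*,
    V*.\<close>
  have *: "mat_adjoint B * mat_adjoint A * (A * B) = 1\<^sub>m k"
    if A: "A \<in> carrier_mat k k" and B: "B \<in> carrier_mat k k"
      and AA: "mat_adjoint A * A = 1\<^sub>m k" and BB: "mat_adjoint B * B = 1\<^sub>m k" for A B :: "complex mat"
  proof -
    have "mat_adjoint B * mat_adjoint A * (A * B) = mat_adjoint B * (mat_adjoint A * (A * B))"
      by (rule assoc_mult_mat[of _ k k _ k _ k]) (use A B in auto)
    also have "mat_adjoint A * (A * B) = (mat_adjoint A * A) * B"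
      by (rule assoc_mult_mat[symmetric, of _ k k _ k _ k]) (use A B in auto)
    finally show ?thesis using AA BB B by simp
  qed
  have VW: "V \<in> carrier_mat k k" "W \<in> carrier_mat k k" using assms by (auto simp: unitary_group_def)
  have "mat_adjoint (V * W) * (V * W) = 1\<^sub>m k"
    unfolding adjoint_mult[OF VW] using assms by (intro *) (auto simp: unitary_group_def)
  moreover have "V * W * mat_adjoint (V * W) = 1\<^sub>m k"
    unfolding adjoint_mult[OF VW] using *[of "mat_adjoint W" "mat_adjoint V"] assms
    by (auto simp: unitary_group_def)
  ultimately show ?thesis using VW by (auto simp: unitary_group_def)
qed

text \<open>The Hilbert-Schmidt norm, without the factor 1 / k inside \<open>tuple_norm2\<close>:
  this is the Euclidean norm that belongs to the Lebesgue measure in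
  \<open>sa_volume\<close>.\<close>

definition frob :: "complex mat \<Rightarrow> real" where
  "frob A = L2_set (\<lambda>(i, j). cmod (A $$ (i, j))) ({..<dim_row A} \<times> {..<dim_col A})"

lemma frob_nonneg [simp]: "0 \<le> frob A"
  by (simp add: frob_def)

lemma L2_set_power2: "(L2_set f A)\<^sup>2 = (\<Sum>i\<in>A. (f i)\<^sup>2)"
  by (simp add: L2_set_def sum_nonneg)

lemma frob_power2: "(frob A)\<^sup>2 = (\<Sum>i<dim_row A. \<Sum>j<dim_col A. (cmod (A $$ (i, j)))\<^sup>2)"
  unfolding frob_def L2_set_power2 sum.cartesian_product by (simp add: case_prod_beta)

lemma frob_power2_cols: "(frob A)\<^sup>2 = (\<Sum>j<dim_col A. (cvec_norm (col A j))\<^sup>2)"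
  unfolding frob_power2 cvec_norm_L2 L2_set_power2 by (subst sum.swap) simp

lemma frob_adjoint [simp]: "frob (mat_adjoint A) = frob A"
proof -
  have "(frob (mat_adjoint A))\<^sup>2 = (frob A)\<^sup>2"
    unfolding frob_power2 by (subst sum.swap) simp
  then show ?thesis by simp
qed

text \<open>Column j of A B is A applied to column j of B, so the bound for vectors can be summed
  over the columns.\<close>

lemma frob_mult_left:
  assumes "A \<in> carrier_mat n m" "B \<in> carrier_mat m l"
  shows "frob (A * B) \<le> mat_op_norm A * frob B"
proof (rule power2_le_imp_le)
  have "(frob (A * B))\<^sup>2 = (\<Sum>j<l. (cvec_norm (col (A * B) j))\<^sup>2)"
    unfolding frob_power2_cols using assms by simp
  also have "\<dots> = (\<Sum>j<l. (cvec_norm (A *\<^sub>v col B j))\<^sup>2)"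
    by (intro sum.cong refl) (simp only: col_mult2[OF assms] lessThan_iff)
  also have "\<dots> \<le> (\<Sum>j<l. (mat_op_norm A * cvec_norm (col B j))\<^sup>2)"
    using assms by (intro sum_mono power_mono cvec_norm_mult_le) auto
  also have "\<dots> = (mat_op_norm A * frob B)\<^sup>2"
    unfolding power_mult_distrib frob_power2_cols using assms by (simp add: sum_distrib_left)
  finally show "(frob (A * B))\<^sup>2 \<le> (mat_op_norm A * frob B)\<^sup>2" .
qed simp

lemma frob_mult_right:
  assumes "A \<in> carrier_mat n m" "B \<in> carrier_mat m l"
  shows "frob (A * B) \<le> frob A * mat_op_norm B"
  using frob_mult_left[of "mat_adjoint B" l m "mat_adjoint A" n] assms
  by (metis adjoint_carrier adjoint_mult frob_adjoint mat_op_norm_adjoint mult.commute)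

lemma frob_triangle:
  assumes "A \<in> carrier_mat n m" "B \<in> carrier_mat n m"
  shows "frob (A + B) \<le> frob A + frob B"
proof -
  have "frob (A + B) \<le> L2_set (\<lambda>p. cmod (A $$ p) + cmod (B $$ p)) ({..<n} \<times> {..<m})"
    unfolding frob_def using assms by (auto intro!: L2_set_mono norm_triangle_ineq simp del: L2_set_nonneg)
  also have "\<dots> \<le> frob A + frob B"
    unfolding frob_def split_def prod.collapse using assms
      L2_set_triangle_ineq[of "\<lambda>p. cmod (A $$ p)" "\<lambda>p. cmod (B $$ p)" "{..<n} \<times> {..<m}"]
    by simp
  finally show ?thesis .
qed

lemma frob_diff_triangle:
  assumes "A \<in> carrier_mat n m" "B \<in> carrier_mat n m" "C \<in> carrier_mat n m"
  shows "frob (A - C) \<le> frob (A - B) + frob (B - C)"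
proof -
  have "A - C = (A - B) + (B - C)" using assms by (intro eq_matI) auto
  then show ?thesis using frob_triangle[of "A - B" n m "B - C"] assms
    minus_carrier_mat[of B n m A] minus_carrier_mat[of C n m B] by simp
qed

lemma frob_minus_commute:
  assumes "A \<in> carrier_mat n m" "B \<in> carrier_mat n m"
  shows "frob (A - B) = frob (B - A)"
  unfolding frob_def using assms by (intro L2_set_cong) (auto simp: norm_minus_commute)

text \<open>Replacing W by V on the left of D and then on the right costs the norm of W - V each
  time, the other unitary factor being a contraction. D enters only through its Hilbert-Schmidt
  norm.\<close>

lemma frob_conj_diff:
  assumes "W \<in> unitary_group k" "V \<in> unitary_group k" "D \<in> carrier_mat k k"
  shows "frob (W * D * mat_adjoint W - V * D * mat_adjoint V) \<le> 2 * mat_op_norm (W - V) * frob D"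
proof -
  note [simp] = unitary_group_carrier[OF assms(1)] unitary_group_carrier[OF assms(2)] assms(3)
  have c: "W * D * mat_adjoint W \<in> carrier_mat k k" "V * D * mat_adjoint W \<in> carrier_mat k k"
     "V * D * mat_adjoint V \<in> carrier_mat k k" "W - V \<in> carrier_mat k k" "W * D \<in> carrier_mat k k"
     "V * D \<in> carrier_mat k k"
    by (meson adjoint_carrier mult_carrier_mat minus_carrier_mat unitary_group_carrier assms)+
  have "frob (W * D * mat_adjoint W - V * D * mat_adjoint W) = frob ((W - V) * D * mat_adjoint W)"
    using c minus_mult_distrib_mat[of "W * D" k k "V * D" "mat_adjoint W" k]
      minus_mult_distrib_mat[of W k k V D k] by simp
  also have "\<dots> \<le> frob ((W - V) * D) * mat_op_norm (mat_adjoint W)"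
    using c by (intro frob_mult_right[of _ k k _ k]) auto
  also have "\<dots> \<le> frob ((W - V) * D) * 1"
    using assms by (intro mult_left_mono mat_op_norm_unitary unitary_group_adjoint) auto
  also have "\<dots> \<le> mat_op_norm (W - V) * frob D"
    using frob_mult_left[of "W - V" k k D k] c by simp
  finally have 1: "frob (W * D * mat_adjoint W - V * D * mat_adjoint W) \<le> mat_op_norm (W - V) * frob D" .
  have "frob (V * D * mat_adjoint W - V * D * mat_adjoint V) = frob (V * D * mat_adjoint (W - V))"
    using c mult_minus_distrib_mat[of "V * D" k k "mat_adjoint W" k "mat_adjoint V"]
      adjoint_minus[of W k k V] by simp
  also have "\<dots> \<le> frob (V * D) * mat_op_norm (mat_adjoint (W - V))"
    using c adjoint_carrier[OF c(4)] by (intro frob_mult_right[of _ k k _ k]) auto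
  also have "\<dots> \<le> frob D * mat_op_norm (W - V)"
  proof (rule mult_mono)
    have "frob (V * D) \<le> mat_op_norm V * frob D"
      by (rule frob_mult_left[of _ k k _ k]) auto
    also have "\<dots> \<le> 1 * frob D"
      using assms by (intro mult_right_mono mat_op_norm_unitary) auto
    finally show "frob (V * D) \<le> frob D" by simp
  qed (use mat_op_norm_adjoint[OF c(4)] in auto)
  finally have 2: "frob (V * D * mat_adjoint W - V * D * mat_adjoint V) \<le> mat_op_norm (W - V) * frob D"
    by (simp add: mult.commute)
  show ?thesis using frob_diff_triangle[OF c(1-3)] 1 2 by linarith
qed

lemma ntr_adjoint_mult:
  assumes "A \<in> carrier_mat k k"
  shows "Re (ntr (mat_adjoint A * A)) = (frob A)\<^sup>2 / k"
proof -
  have "(\<Sum>i<k. (mat_adjoint A * A) $$ (i, i)) = (\<Sum>i<k. \<Sum>j<k. complex_of_real ((cmod (A $$ (j, i)))\<^sup>2))"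
    using assms by (intro sum.cong refl)
      (auto simp: scalar_prod_def atLeast0LessThan complex_norm_square mult.commute simp del: of_real_power intro!: sum.cong)
  also have "\<dots> = complex_of_real ((frob A)\<^sup>2)"
    unfolding frob_power2 using assms by (subst sum.swap) simp
  finally show ?thesis using assms by (simp add: ntr_def)
qed

section \<open>Tuples of matrices and their unitary orbits\<close>

definition tuple_frob :: "complex mat list \<Rightarrow> real" where
  "tuple_frob As = L2_set (\<lambda>l. frob (As ! l)) {..<length As}"

definition tuple_dist :: "complex mat list \<Rightarrow> complex mat list \<Rightarrow> real" where
  "tuple_dist As Bs = L2_set (\<lambda>l. frob (As ! l - Bs ! l)) {..<length As}"

definition conj_tuple :: "complex mat \<Rightarrow> complex mat list \<Rightarrow> complex mat list" where
  "conj_tuple W Bs = map (\<lambda>B. W * B * mat_adjoint W) Bs"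

lemma tuple_norm2_eq:
  assumes "As \<in> mat_tuples n k"
  shows "tuple_norm2 As = tuple_frob As / sqrt k"
proof -
  have "(\<Sum>A\<leftarrow>As. Re (ntr (mat_adjoint A * A))) = (\<Sum>l<length As. (frob (As ! l))\<^sup>2 / k)"
    unfolding sum_list_sum_nth atLeast0LessThan using assms
    by (auto intro!: sum.cong ntr_adjoint_mult simp: mat_tuples_def)
  then show ?thesis
    unfolding tuple_norm2_def tuple_frob_def L2_set_def
    by (simp add: sum_divide_distrib[symmetric] real_sqrt_divide)
qed

lemma mat_tuples_nth: "As \<in> mat_tuples n k \<Longrightarrow> l < n \<Longrightarrow> As ! l \<in> carrier_mat k k"
  by (auto simp: mat_tuples_def)

lemma mat_tuples_length: "As \<in> mat_tuples n k \<Longrightarrow> length As = n"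
  by (auto simp: mat_tuples_def)

lemma conj_tuple_in:
  assumes "W \<in> carrier_mat k k" "Bs \<in> mat_tuples n k"
  shows "conj_tuple W Bs \<in> mat_tuples n k"
  using assms by (auto simp: mat_tuples_def conj_tuple_def)

text \<open>Translates the condition in \<open>orbit_ball\<close> into Euclidean terms: radius
  \<omega> there is radius \<omega> sqrt k in \<open>tuple_dist\<close>.\<close>

lemma tuple_norm2_orbit:
  assumes "As \<in> mat_tuples n k" "Bs \<in> mat_tuples n k" "W \<in> carrier_mat k k"
  shows "tuple_norm2 (map2 (\<lambda>A B. A - W * B * mat_adjoint W) As Bs) = tuple_dist As (conj_tuple W Bs) / sqrt k"
proof -
  have len: "length As = n" "length Bs = n" using assms by (auto simp: mat_tuples_def)
  have "map2 (\<lambda>A B. A - W * B * mat_adjoint W) As Bs \<in> mat_tuples n k"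
    using assms len by (auto simp: mat_tuples_def set_zip)
  then have "tuple_norm2 (map2 (\<lambda>A B. A - W * B * mat_adjoint W) As Bs)
     = tuple_frob (map2 (\<lambda>A B. A - W * B * mat_adjoint W) As Bs) / sqrt k"
    by (rule tuple_norm2_eq)
  also have "tuple_frob (map2 (\<lambda>A B. A - W * B * mat_adjoint W) As Bs) = tuple_dist As (conj_tuple W Bs)"
    unfolding tuple_frob_def tuple_dist_def conj_tuple_def using len by (auto intro!: L2_set_cong)
  finally show ?thesis .
qed

lemma tuple_dist_triangle:
  assumes "As \<in> mat_tuples n k" "Bs \<in> mat_tuples n k" "Cs \<in> mat_tuples n k"
  shows "tuple_dist As Cs \<le> tuple_dist As Bs + tuple_dist Bs Cs"
proof -
  have "tuple_dist As Cs \<le> L2_set (\<lambda>l. frob (As ! l - Bs ! l) + frob (Bs ! l - Cs ! l)) {..<n}"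
    unfolding tuple_dist_def mat_tuples_length[OF assms(1)]
    by (intro L2_set_mono frob_diff_triangle[of _ k k]) (use assms in \<open>auto intro: mat_tuples_nth\<close>)
  also have "\<dots> \<le> tuple_dist As Bs + tuple_dist Bs Cs"
    unfolding tuple_dist_def mat_tuples_length[OF assms(1)] mat_tuples_length[OF assms(2)]
    by (rule L2_set_triangle_ineq)
  finally show ?thesis .
qed

lemma tuple_dist_commute:
  assumes "As \<in> mat_tuples n k" "Bs \<in> mat_tuples n k"
  shows "tuple_dist As Bs = tuple_dist Bs As"
  unfolding tuple_dist_def mat_tuples_length[OF assms(1)] mat_tuples_length[OF assms(2)]
  using assms by (intro L2_set_cong refl frob_minus_commute) (auto intro: mat_tuples_nth)

lemma tuple_dist_conj:
  assumes "W \<in> unitary_group k" "V \<in> unitary_group k" "Bs \<in> mat_tuples n k"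
  shows "tuple_dist (conj_tuple W Bs) (conj_tuple V Bs) \<le> 2 * mat_op_norm (W - V) * tuple_frob Bs"
proof -
  have "tuple_dist (conj_tuple W Bs) (conj_tuple V Bs) \<le> L2_set (\<lambda>l. 2 * mat_op_norm (W - V) * frob (Bs ! l)) {..<length Bs}"
    unfolding tuple_dist_def using assms
    by (auto simp: conj_tuple_def intro!: L2_set_mono frob_conj_diff intro: mat_tuples_nth simp: mat_tuples_length)
  also have "\<dots> = 2 * mat_op_norm (W - V) * tuple_frob Bs"
    unfolding tuple_frob_def by (simp add: L2_set_right_distrib)
  finally show ?thesis .
qed

lemma unitary_conj_cancel:
  assumes "W \<in> unitary_group k" "D \<in> carrier_mat k k"
  shows "mat_adjoint W * (W * D * mat_adjoint W) * W = D"
proof -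
  note W = unitary_group_carrier[OF assms(1)] 
  note W' = adjoint_carrier[OF W] and D = assms(2)
  have *: "mat_adjoint W * W = 1\<^sub>m k" using assms by (simp add: unitary_group_def)
  have "mat_adjoint W * (W * D * mat_adjoint W) * W = mat_adjoint W * (W * (D * mat_adjoint W)) * W"
    using assoc_mult_mat[OF W D W'] by simp
  also have "\<dots> = (mat_adjoint W * W) * (D * mat_adjoint W) * W"
    using assoc_mult_mat[OF W' W mult_carrier_mat[OF D W']] by simp
  also have "\<dots> = D * mat_adjoint W * W"
    using * D W' by simp
  also have "\<dots> = D"
    by (simp only: assoc_mult_mat[OF D W' W] * right_mult_one_mat[OF D])
  finally show ?thesis .
qed

lemma frob_le_conj:
  assumes "W \<in> unitary_group k" "D \<in> carrier_mat k k"
  shows "frob D \<le> frob (W * D * mat_adjoint W)"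
proof -
  note W = unitary_group_carrier[OF assms(1)]
  note W' = adjoint_carrier[OF W] and D = assms(2)
  have c: "W * D * mat_adjoint W \<in> carrier_mat k k" using W W' D by (meson mult_carrier_mat)
  have "frob D = frob (mat_adjoint W * (W * D * mat_adjoint W) * W)"
    using unitary_conj_cancel[OF assms] by simp
  also have "\<dots> \<le> frob (mat_adjoint W * (W * D * mat_adjoint W)) * mat_op_norm W"
    by (rule frob_mult_right[OF mult_carrier_mat[OF W' c] W])
  also have "\<dots> \<le> frob (mat_adjoint W * (W * D * mat_adjoint W)) * 1"
    using assms by (intro mult_left_mono mat_op_norm_unitary) auto
  also have "\<dots> \<le> mat_op_norm (mat_adjoint W) * frob (W * D * mat_adjoint W)"
    using frob_mult_left[OF W' c] by simp
  also have "\<dots> \<le> 1 * frob (W * D * mat_adjoint W)"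
    using assms by (intro mult_right_mono mat_op_norm_unitary unitary_group_adjoint) auto
  finally show ?thesis by simp
qed

text \<open>Controls a covering centre Bs through a point As of its orbit ball. The Lipschitz
  constant in \<open>tuple_dist_conj\<close> contains \<open>tuple_frob Bs\<close>, so this keeps
  that constant independent of the cutoff R.\<close>

lemma tuple_frob_le_orbit:
  assumes "W \<in> unitary_group k" "As \<in> mat_tuples n k" "Bs \<in> mat_tuples n k"
  shows "tuple_frob Bs \<le> tuple_frob As + tuple_dist As (conj_tuple W Bs)"
proof -
  note len = mat_tuples_length[OF assms(2)] mat_tuples_length[OF assms(3)]
  have "frob (Bs ! l) \<le> frob (As ! l) + frob (As ! l - conj_tuple W Bs ! l)" if l: "l < n" for l
  proof -
    have c: "conj_tuple W Bs ! l \<in> carrier_mat k k" "As ! l \<in> carrier_mat k k" "Bs ! l \<in> carrier_mat k k"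
      using conj_tuple_in[OF unitary_group_carrier[OF assms(1)] assms(3)] assms l by (auto intro: mat_tuples_nth)
    have "frob (Bs ! l) \<le> frob (conj_tuple W Bs ! l)"
      using frob_le_conj[OF assms(1) c(3)] l len by (simp add: conj_tuple_def)
    moreover have "conj_tuple W Bs ! l = As ! l + (conj_tuple W Bs ! l - As ! l)"
      using c by (intro eq_matI) auto
    ultimately show ?thesis
      using frob_triangle[of "As ! l" k k "conj_tuple W Bs ! l - As ! l"] c
        frob_minus_commute[of "As ! l" k k "conj_tuple W Bs ! l"]
        minus_carrier_mat[of "As ! l" k k "conj_tuple W Bs ! l"] by simp
  qed
  then have "tuple_frob Bs \<le> L2_set (\<lambda>l. frob (As ! l) + frob (As ! l - conj_tuple W Bs ! l)) {..<n}"
    unfolding tuple_frob_def len by (intro L2_set_mono) auto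
  also have "\<dots> \<le> tuple_frob As + tuple_dist As (conj_tuple W Bs)"
    unfolding tuple_frob_def tuple_dist_def len by (rule L2_set_triangle_ineq)
  finally show ?thesis .
qed

text \<open>One member of \<open>sa_tuple_of_coords\<close> by itself: a real-linear parametrisation
  of the self-adjoint matrices by k^2 real numbers. It serves twice, for microstates and for the
  skew-adjoint part of a unitary.\<close>

definition herm :: "nat \<Rightarrow> (nat \<times> nat \<Rightarrow> real) \<Rightarrow> complex mat" where
  "herm k u = Matrix.mat k k (\<lambda>(i, j).
            if i = j then complex_of_real (u (i, i))
            else if i < j then Complex (u (i, j)) (u (j, i)) / complex_of_real (sqrt 2)
            else Complex (u (j, i)) (- u (i, j)) / complex_of_real (sqrt 2))"

lemma sa_tuple_of_coords_herm: "sa_tuple_of_coords n k t = map (\<lambda>l. herm k (\<lambda>p. t (l, p))) [0..<n]"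
  unfolding sa_tuple_of_coords_def herm_def ..

lemma herm_carrier [simp]: "herm k u \<in> carrier_mat k k" "dim_row (herm k u) = k" "dim_col (herm k u) = k"
  by (auto simp: herm_def)

lemma herm_minus: "herm k u - herm k v = herm k (\<lambda>p. u p - v p)"
  by (rule eq_matI) (auto simp: herm_def complex_eq_iff diff_divide_distrib)

lemma herm_add: "herm k u + herm k v = herm k (\<lambda>p. u p + v p)"
  by (rule eq_matI) (auto simp: herm_def complex_eq_iff add_divide_distrib diff_divide_distrib)

lemma herm_smult: "complex_of_real c \<cdot>\<^sub>m herm k v = herm k (\<lambda>p. c * v p)"
  by (rule eq_matI) (auto simp: herm_def complex_eq_iff)

lemma herm_adjoint [simp]: "mat_adjoint (herm k u) = herm k u"
  by (rule eq_matI) (auto simp: herm_def complex_eq_iff)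

text \<open>The entries at (i, j) and (j, i) both have squared modulus equal to the mean of two
  squared coordinates, so the sum over all pairs counts each coordinate once.\<close>

lemma frob_herm: "frob (herm k u) = L2_set u ({..<k} \<times> {..<k})"
proof -
  have *: "(cmod (herm k u $$ (i, j)))\<^sup>2 = ((u (i, j))\<^sup>2 + (u (j, i))\<^sup>2) / 2" if "i < k" "j < k" for i j
    using that by (auto simp: herm_def cmod_power2 norm_divide power_divide)
  have "(frob (herm k u))\<^sup>2 = (\<Sum>i<k. \<Sum>j<k. ((u (i, j))\<^sup>2 + (u (j, i))\<^sup>2) / 2)"
    unfolding frob_power2 by (simp add: *)
  also have "\<dots> = ((\<Sum>i<k. \<Sum>j<k. (u (i, j))\<^sup>2) + (\<Sum>i<k. \<Sum>j<k. (u (j, i))\<^sup>2)) / 2"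
    by (simp add: sum.distrib sum_divide_distrib[symmetric])
  also have "(\<Sum>i<k. \<Sum>j<k. (u (j, i))\<^sup>2) = (\<Sum>i<k. \<Sum>j<k. (u (i, j))\<^sup>2)"
    by (rule sum.swap)
  also have "((\<Sum>i<k. \<Sum>j<k. (u (i, j))\<^sup>2) + (\<Sum>i<k. \<Sum>j<k. (u (i, j))\<^sup>2)) / 2 = (L2_set u ({..<k} \<times> {..<k}))\<^sup>2"
    unfolding L2_set_power2 sum.cartesian_product by (simp add: case_prod_beta)
  finally show ?thesis by simp
qed

text \<open>Together with the next lemma, this supplies the assumptions \<open>upper\<close> and
  \<open>lower\<close> of \<open>coord_norm_mat_op_norm\<close> for \<open>herm\<close>.\<close>

lemma index_herm_le:
  assumes "i < k" "j < k"
  shows "cmod (herm k u $$ (i, j)) \<le> \<bar>u (i, j)\<bar> + \<bar>u (j, i)\<bar>"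
proof -
  have "cmod (Complex x y) / sqrt 2 \<le> \<bar>x\<bar> + \<bar>y\<bar>" for x y
  proof -
    have "cmod (Complex x y) / sqrt 2 \<le> cmod (Complex x y) / 1"
      by (intro divide_left_mono) auto
    then show ?thesis using cmod_le[of "Complex x y"] by simp
  qed
  from this[of "u (i,j)" "u (j,i)"] this[of "u (j,i)" "- u (i,j)"] show ?thesis
    using assms by (auto simp: herm_def norm_divide)
qed

lemma coord_le_index_herm:
  assumes "i < k" "j < k"
  shows "\<bar>u (i, j)\<bar> \<le> sqrt 2 * cmod (herm k u $$ (i, j))"
proof -
  have "\<bar>x\<bar> \<le> sqrt 2 * \<bar>x\<bar>" for x :: real
    using mult_right_mono[of 1 "sqrt 2" "\<bar>x\<bar>"] by simp
  then show ?thesis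
    using assms abs_Re_le_cmod[of "Complex (u (i,j)) (u (j,i))"] abs_Im_le_cmod[of "Complex (u (j,i)) (- u (i,j))"]
    by (auto simp: herm_def norm_divide)
qed

lemma hermE:
  assumes A: "A \<in> carrier_mat k k" "mat_adjoint A = A"
  obtains u where "A = herm k u"
proof
  \<comment> \<open>Inverts \<open>herm\<close>: the factor sqrt 2 undoes the normalisation, and
    positions below the diagonal hold the imaginary part of the mirrored upper entry.\<close>
  define u where "u = (\<lambda>(i, j). if i = j then Re (A $$ (i, i)) else if i < j then sqrt 2 * Re (A $$ (i, j))
      else sqrt 2 * Im (A $$ (j, i)))"
  have *: "A $$ (i, j) = cnj (A $$ (j, i))" if "i < k" "j < k" for i j
    using index_adjoint[of i A j] A that by simp
  show "A = herm k u"
  proof (rule eq_matI)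
    fix i j assume "i < dim_row (herm k u)" "j < dim_col (herm k u)"
    then have ij: "i < k" "j < k" by auto
    show "A $$ (i, j) = herm k u $$ (i, j)"
      using ij *[of i j] *[of i i] by (auto simp: herm_def u_def complex_eq_iff)
  qed (use A in auto)
qed

text \<open>Turns closeness in \<open>tuple_dist\<close> into membership in a Euclidean ball of
  coordinate space, whose volume can be bounded.\<close>

lemma tuple_dist_sa_tuple_of_coords:
  "tuple_dist (sa_tuple_of_coords n k s) (sa_tuple_of_coords n k t)
     = L2_set (\<lambda>i. s i - t i) ({..<n} \<times> {..<k} \<times> {..<k})"
proof -
  have "(tuple_dist (sa_tuple_of_coords n k s) (sa_tuple_of_coords n k t))\<^sup>2
    = (\<Sum>l<n. (L2_set (\<lambda>p. s (l, p) - t (l, p)) ({..<k} \<times> {..<k}))\<^sup>2)"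
    unfolding tuple_dist_def L2_set_power2 sa_tuple_of_coords_herm
    by (auto simp: herm_minus frob_herm L2_set_power2 intro!: sum.cong)
  also have "\<dots> = (L2_set (\<lambda>i. s i - t i) ({..<n} \<times> {..<k} \<times> {..<k}))\<^sup>2"
    unfolding L2_set_power2 sum.cartesian_product by (simp add: case_prod_beta)
  finally show ?thesis
    by (simp add: tuple_dist_def)
qed

lemma sa_tuple_of_coords_in: "sa_tuple_of_coords n k t \<in> mat_tuples n k"
  by (auto simp: mat_tuples_def sa_tuple_of_coords_herm)


section \<open>Packing and Gaussian bounds in coordinates\<close>

text \<open>A separated subset of largest cardinality is a net, since a point far from all its
  members could be added. The bound N guarantees that a largest one exists.\<close>

lemma separated_net:
  fixes d :: "'a \<Rightarrow> 'a \<Rightarrow> real" and N :: nat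
  assumes bound: "\<And>F. finite F \<Longrightarrow> F \<subseteq> S \<Longrightarrow> (\<And>x y. x \<in> F \<Longrightarrow> y \<in> F \<Longrightarrow> x \<noteq> y \<Longrightarrow> \<eta> < d x y) \<Longrightarrow> card F \<le> N"
    and sym: "\<And>x y. d x y = d y x" and refl: "\<And>x. d x x \<le> \<eta>"
  obtains F where "finite F" "F \<subseteq> S" "card F \<le> N" "\<And>x. x \<in> S \<Longrightarrow> \<exists>y\<in>F. d x y \<le> \<eta>"
proof -
  define P where "P F \<longleftrightarrow> finite F \<and> F \<subseteq> S \<and> (\<forall>x\<in>F. \<forall>y\<in>F. x \<noteq> y \<longrightarrow> \<eta> < d x y)" for F
  have "P {}" by (simp add: P_def)
  moreover have "\<forall>F. P F \<longrightarrow> card F \<le> N" using bound by (simp add: P_def)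
  ultimately obtain F where F: "P F" "\<And>G. P G \<Longrightarrow> card G \<le> card F"
    using ex_has_greatest_nat[of P "{}" card "Suc N"] by (auto simp: less_Suc_eq_le)
  have "\<exists>y\<in>F. d x y \<le> \<eta>" if "x \<in> S" for x
  proof (rule ccontr)
    assume *: "\<not> (\<exists>y\<in>F. d x y \<le> \<eta>)"
    then have "x \<notin> F" using refl by blast
    moreover have "P (insert x F)" using * F(1) that sym unfolding P_def by (auto simp: not_le)
    ultimately show False using F(2)[of "insert x F"] F(1) by (simp add: P_def)
  qed
  moreover have "finite F" "F \<subseteq> S" "card F \<le> N" using F(1) bound by (auto simp: P_def)
  ultimately show thesis using that by metis
qed

section \<open>Lebesgue measure in finitely many coordinates under translations and
  dilations\<close>

abbreviation leb :: "'i set \<Rightarrow> ('i \<Rightarrow> real) measure" where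
  "leb I \<equiv> Pi\<^sub>M I (\<lambda>_. lborel)"

interpretation leb: product_sigma_finite "\<lambda>_::'i. lborel :: real measure"
  by standard

lemma measurable_affine:
  assumes "finite I"
  shows "(\<lambda>u. \<lambda>i\<in>I. f i + c * u i) \<in> measurable (leb I) (leb I)"
  by (rule measurable_restrict) measurable

text \<open>A product measure is determined by its values on boxes, and on a box the identity splits
  into the one-dimensional \<open>lborel_real_affine\<close> in each coordinate.\<close>

lemma distr_affine:
  fixes c :: real
  assumes I: "finite I" and c: "0 < c"
  shows "leb I = density (distr (leb I) (leb I) (\<lambda>u. \<lambda>i\<in>I. f i + c * u i)) (\<lambda>_. ennreal (c ^ card I))"
proof (rule leb.PiM_eqI[OF I, symmetric])
  let ?T = "\<lambda>u. \<lambda>i\<in>I. f i + c * u i"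
  fix A :: "'a \<Rightarrow> real set" assume A: "\<And>i. i \<in> I \<Longrightarrow> A i \<in> sets lborel"
  have AI: "Pi\<^sub>E I A \<in> sets (leb I)" using A by (intro sets_PiM_I_finite I)
  define B where "B i = (\<lambda>x. f i + c * x) -` A i" for i
  have B: "B i \<in> sets lborel" if "i \<in> I" for i
    using measurable_sets[of "\<lambda>x. f i + c * x" borel borel "A i"] A[OF that] unfolding B_def by simp
  have "?T -` Pi\<^sub>E I A \<inter> space (leb I) = Pi\<^sub>E I B"
    by (auto simp: B_def space_PiM PiE_iff)
  then have "emeasure (distr (leb I) (leb I) ?T) (Pi\<^sub>E I A) = (\<Prod>i\<in>I. emeasure lborel (B i))"
    using B by (subst emeasure_distr[OF measurable_affine[OF I] AI]) (simp add: leb.emeasure_PiM[OF I])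
  then have "emeasure (density (distr (leb I) (leb I) ?T) (\<lambda>_. ennreal (c ^ card I))) (Pi\<^sub>E I A)
      = ennreal (c ^ card I) * (\<Prod>i\<in>I. emeasure lborel (B i))"
    using AI by (subst emeasure_density_const) auto
  also have "\<dots> = (\<Prod>i\<in>I. ennreal c * emeasure lborel (B i))"
    using c by (simp add: prod.distrib ennreal_power)
  also have "\<dots> = (\<Prod>i\<in>I. emeasure lborel (A i))"
  proof (rule prod.cong[OF refl])
    fix i assume i: "i \<in> I"
    have "emeasure lborel (A i) = emeasure (density (distr lborel borel (\<lambda>x. f i + c * x)) (\<lambda>_. ennreal \<bar>c\<bar>)) (A i)"
      using lborel_real_affine[of c "f i"] c by simp
    also have "\<dots> = ennreal c * emeasure lborel (B i)"
      using A[OF i] c by (subst emeasure_density_const) (auto simp: emeasure_distr B_def)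
    finally show "ennreal c * emeasure lborel (B i) = emeasure lborel (A i)" ..
  qed
  finally show "emeasure (density (distr (leb I) (leb I) ?T) (\<lambda>_. ennreal (c ^ card I))) (Pi\<^sub>E I A)
      = (\<Prod>i\<in>I. emeasure lborel (A i))" .
qed simp

lemma emeasure_affine:
  assumes "finite I" "0 < c" "S \<in> sets (leb I)"
  shows "emeasure (leb I) S = ennreal (c ^ card I) *
    emeasure (leb I) ((\<lambda>u. \<lambda>i\<in>I. f i + c * u i) -` S \<inter> space (leb I))"
  using assms
  by (subst distr_affine[OF assms(1,2), of f])
    (subst emeasure_density_const, auto simp: emeasure_distr[OF measurable_affine[OF assms(1)]])

text \<open>A norm on real functions on I, given on total functions so that centres and differences
  may be arbitrary off I; \<open>local\<close> makes the values there irrelevant. By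
  \<open>upper\<close> and \<open>lower\<close> the unit ball contains a cube and lies in a cube,
  whence its volume is positive and finite. The instances are operator norms of matrices in real
  coordinates.\<close>

locale coord_norm =
  fixes I :: "'i set" and p :: "('i \<Rightarrow> real) \<Rightarrow> real"
  assumes fin: "finite I"
    and local: "\<And>s t. (\<And>i. i \<in> I \<Longrightarrow> s i = t i) \<Longrightarrow> p s = p t"
    and scale: "\<And>c t. p (\<lambda>i. c * t i) = \<bar>c\<bar> * p t"
    and triangle: "\<And>s t. p (\<lambda>i. s i + t i) \<le> p s + p t"
    and meas [measurable]: "p \<in> borel_measurable (leb I)"
    and upper: "\<exists>a>0. \<forall>t. (\<forall>i\<in>I. \<bar>t i\<bar> < a) \<longrightarrow> p t < 1"
    and lower: "\<exists>b. \<forall>t. p t < 1 \<longrightarrow> (\<forall>i\<in>I. \<bar>t i\<bar> \<le> b)"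
begin

definition cell :: "('i \<Rightarrow> real) \<Rightarrow> real \<Rightarrow> ('i \<Rightarrow> real) set" where
  "cell f c = {t \<in> space (leb I). p (\<lambda>i. t i - f i) < c}"

lemma cell_sets [measurable]: "cell f c \<in> sets (leb I)"
proof -
  \<comment> \<open>The translation has to land in the extensional functions, hence the restriction
    to I, which \<open>local\<close> removes afterwards.\<close>
  have "(\<lambda>t. \<lambda>i\<in>I. - f i + 1 * t i) \<in> measurable (leb I) (leb I)"
    by (rule measurable_affine[OF fin, of "\<lambda>i. - f i" 1])
  from measurable_compose[OF this meas]
  have "(\<lambda>t. p (\<lambda>i\<in>I. - f i + 1 * t i)) \<in> borel_measurable (leb I)" .
  moreover have "p (\<lambda>i\<in>I. - f i + 1 * t i) = p (\<lambda>i. t i - f i)" for t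
    by (rule local) auto
  ultimately have [measurable]: "(\<lambda>t. p (\<lambda>i. t i - f i)) \<in> borel_measurable (leb I)" by (simp only:)
  show ?thesis unfolding cell_def by measurable
qed

lemma emeasure_cell:
  assumes "0 < c"
  shows "emeasure (leb I) (cell f c) = ennreal (c ^ card I) * emeasure (leb I) (cell (\<lambda>_. 0) 1)"
proof -
  have "p (\<lambda>i. (\<lambda>i\<in>I. f i + c * u i) i - f i) < c \<longleftrightarrow> p u < 1" for u
  proof -
    have "p (\<lambda>i. (\<lambda>i\<in>I. f i + c * u i) i - f i) = p (\<lambda>i. c * u i)"
      by (rule local) auto
    then show ?thesis using assms by (simp add: scale)
  qed
  then have "(\<lambda>u. \<lambda>i\<in>I. f i + c * u i) -` cell f c \<inter> space (leb I) = cell (\<lambda>_. 0) 1"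
    by (auto simp: cell_def space_PiM)
  then show ?thesis by (simp add: emeasure_affine[OF fin assms cell_sets, of f c f])
qed

lemma emeasure_unit_cell:
  "emeasure (leb I) (cell (\<lambda>_. 0) 1) \<noteq> 0" "emeasure (leb I) (cell (\<lambda>_. 0) 1) \<noteq> \<infinity>"
proof -
  obtain a where a: "a > 0" "\<And>t. (\<forall>i\<in>I. \<bar>t i\<bar> < a) \<Longrightarrow> p t < 1" using upper by blast
  have "Pi\<^sub>E I (\<lambda>_. {-a<..<a}) \<subseteq> cell (\<lambda>_. 0) 1"
    by (auto simp: cell_def space_PiM PiE_iff abs_less_iff minus_less_iff intro!: a(2))
  then have "emeasure (leb I) (Pi\<^sub>E I (\<lambda>_. {-a<..<a})) \<le> emeasure (leb I) (cell (\<lambda>_. 0) 1)"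
    by (rule emeasure_mono) measurable
  moreover have "emeasure (leb I) (Pi\<^sub>E I (\<lambda>_. {-a<..<a})) = ennreal ((2 * a) ^ card I)"
    using a by (simp add: leb.emeasure_PiM[OF fin] ennreal_power)
  ultimately show "emeasure (leb I) (cell (\<lambda>_. 0) 1) \<noteq> 0"
    using zero_less_power[of "2 * a" "card I"] a
    by (auto simp: ennreal_eq_0_iff simp del: zero_less_power power_mult_distrib power_mult_numeral)
  obtain b0 where b0: "\<And>t. p t < 1 \<Longrightarrow> (\<forall>i\<in>I. \<bar>t i\<bar> \<le> b0)" using lower by blast
  \<comment> \<open>The absolute value keeps the bound nonnegative when I is empty, where
    \<open>lower\<close> puts no condition on it.\<close>
  define b where "b = \<bar>b0\<bar>"
  have b: "\<And>t. p t < 1 \<Longrightarrow> (\<forall>i\<in>I. \<bar>t i\<bar> \<le> b)" "0 \<le> b" using b0 unfolding b_def by fastforce+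
  have "cell (\<lambda>_. 0) 1 \<subseteq> Pi\<^sub>E I (\<lambda>_. {-b..b})"
  proof
    fix t assume "t \<in> cell (\<lambda>_. 0) 1"
    then have "t \<in> space (leb I)" "\<forall>i\<in>I. \<bar>t i\<bar> \<le> b" using b(1)[of t] by (auto simp: cell_def)
    then show "t \<in> Pi\<^sub>E I (\<lambda>_. {-b..b})" by (auto simp: space_PiM PiE_iff abs_le_iff minus_le_iff)
  qed
  then have "emeasure (leb I) (cell (\<lambda>_. 0) 1) \<le> emeasure (leb I) (Pi\<^sub>E I (\<lambda>_. {-b..b}))"
    by (rule emeasure_mono) (auto intro!: sets_PiM_I_finite fin)
  also have "\<dots> = ennreal ((2 * b) ^ card I)"
    using b by (simp add: leb.emeasure_PiM[OF fin] ennreal_power)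
  also have "\<dots> < \<infinity>" by simp
  finally show "emeasure (leb I) (cell (\<lambda>_. 0) 1) \<noteq> \<infinity>" by simp
qed

text \<open>Balls of radius \<eta> / 2 around the points are disjoint and lie in the ball of radius
  r + \<eta> / 2 around 0. Each volume is a power of the radius times the volume of the unit ball,
  which cancels; so the bound is the same for every norm.\<close>

lemma separated_card_le:
  assumes F: "finite F" "\<And>f. f \<in> F \<Longrightarrow> p f \<le> r" and \<eta>: "0 < \<eta>" and r: "0 \<le> r"
    and sep: "\<And>f g. f \<in> F \<Longrightarrow> g \<in> F \<Longrightarrow> f \<noteq> g \<Longrightarrow> \<eta> < p (\<lambda>i. f i - g i)"
  shows "real (card F) \<le> (1 + 2 * r / \<eta>) ^ card I"
proof -
  define v where "v = enn2real (emeasure (leb I) (cell (\<lambda>_. 0) 1))"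
  have v: "emeasure (leb I) (cell (\<lambda>_. 0) 1) = ennreal v" "v > 0"
    using emeasure_unit_cell unfolding v_def by (auto simp: less_top enn2real_positive_iff zero_less_iff_neq_zero)
  have disj: "disjoint_family_on (\<lambda>f. cell f (\<eta> / 2)) F"
      unfolding disjoint_family_on_def
  proof (intro ballI impI, rule ccontr)
    fix f g assume fg: "f \<in> F" "g \<in> F" "f \<noteq> g" and "cell f (\<eta> / 2) \<inter> cell g (\<eta> / 2) \<noteq> {}"
    then obtain t where t: "p (\<lambda>i. t i - f i) < \<eta> / 2" "p (\<lambda>i. t i - g i) < \<eta> / 2"
      by (auto simp: cell_def)
    have "p (\<lambda>i. f i - g i) = p (\<lambda>i. (-1) * (t i - f i) + (t i - g i))" by (rule local) auto
    also have "\<dots> \<le> p (\<lambda>i. (-1) * (t i - f i)) + p (\<lambda>i. t i - g i)" by (rule triangle)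
    also have "p (\<lambda>i. (-1) * (t i - f i)) = p (\<lambda>i. t i - f i)" by (subst scale) simp
    finally show False using t sep[OF fg] by simp
  qed
  have "(\<Union>f\<in>F. cell f (\<eta> / 2)) \<subseteq> cell (\<lambda>_. 0) (r + \<eta> / 2)"
  proof
    fix t assume "t \<in> (\<Union>f\<in>F. cell f (\<eta> / 2))"
    then obtain f where "f \<in> F" and t: "p (\<lambda>i. t i - f i) < \<eta> / 2" "t \<in> space (leb I)"
      by (auto simp: cell_def)
    have "p t = p (\<lambda>i. (t i - f i) + f i)" by (rule local) auto
    also have "\<dots> \<le> p (\<lambda>i. t i - f i) + p f" by (rule triangle)
    finally show "t \<in> cell (\<lambda>_. 0) (r + \<eta> / 2)" using t F(2)[OF \<open>f \<in> F\<close>] by (simp add: cell_def)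
  qed
  then have "emeasure (leb I) (\<Union>f\<in>F. cell f (\<eta> / 2)) \<le> emeasure (leb I) (cell (\<lambda>_. 0) (r + \<eta> / 2))"
    by (rule emeasure_mono) simp
  also have "emeasure (leb I) (\<Union>f\<in>F. cell f (\<eta> / 2)) = (\<Sum>f\<in>F. emeasure (leb I) (cell f (\<eta> / 2)))"
    by (rule sum_emeasure[symmetric]) (use disj F in auto)
  also have "\<dots> = ennreal (real (card F) * ((\<eta> / 2) ^ card I * v))"
    using emeasure_cell[of "\<eta> / 2"] \<eta> v by (simp add: ennreal_mult ennreal_of_nat_eq_real_of_nat)
  also have "emeasure (leb I) (cell (\<lambda>_. 0) (r + \<eta> / 2)) = ennreal ((r + \<eta> / 2) ^ card I * v)"
    using emeasure_cell[of "r + \<eta> / 2"] \<eta> r v by (simp add: ennreal_mult)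
  finally have "real (card F) * ((\<eta> / 2) ^ card I * v) \<le> (r + \<eta> / 2) ^ card I * v"
    using \<eta> r v by (subst (asm) ennreal_le_iff) auto
  then have "real (card F) * (\<eta> / 2) ^ card I \<le> (r + \<eta> / 2) ^ card I"
    using v by simp
  then have "real (card F) \<le> ((r + \<eta> / 2) / (\<eta> / 2)) ^ card I"
    using \<eta> by (subst power_divide, subst pos_le_divide_eq) auto
  also have "(r + \<eta> / 2) / (\<eta> / 2) = 1 + 2 * r / \<eta>" using \<eta> by (simp add: field_simps)
  finally show ?thesis .
qed

text \<open>The net is taken inside S itself. In the applications S consists of coordinates that
  come from unitaries, so every net point yields a unitary.\<close>

lemma net:
  assumes S: "\<And>t. t \<in> S \<Longrightarrow> p t \<le> r" and \<eta>: "0 < \<eta>" and r: "0 \<le> r"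
  obtains F where "finite F" "F \<subseteq> S" "real (card F) \<le> (1 + 2 * r / \<eta>) ^ card I"
    "\<And>s. s \<in> S \<Longrightarrow> \<exists>f\<in>F. p (\<lambda>i. s i - f i) \<le> \<eta>"
proof -
  have "\<exists>F. finite F \<and> F \<subseteq> S \<and> card F \<le> nat \<lfloor>(1 + 2 * r / \<eta>) ^ card I\<rfloor> \<and> (\<forall>s\<in>S. \<exists>f\<in>F. p (\<lambda>i. s i - f i) \<le> \<eta>)"
  proof (rule separated_net[of S \<eta> "\<lambda>s f. p (\<lambda>i. s i - f i)" "nat \<lfloor>(1 + 2 * r / \<eta>) ^ card I\<rfloor>"])
    fix F assume F: "finite F" "F \<subseteq> S" "\<And>x y. x \<in> F \<Longrightarrow> y \<in> F \<Longrightarrow> x \<noteq> y \<Longrightarrow> \<eta> < p (\<lambda>i. x i - y i)"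
    have "real (card F) \<le> (1 + 2 * r / \<eta>) ^ card I"
      by (rule separated_card_le) (use F S \<eta> r in auto)
    then show "card F \<le> nat \<lfloor>(1 + 2 * r / \<eta>) ^ card I\<rfloor>" by linarith
  next
    fix x y :: "'i \<Rightarrow> real"
    have "p (\<lambda>i. x i - y i) = p (\<lambda>i. (-1) * (y i - x i))" by (rule local) auto
    then show "p (\<lambda>i. x i - y i) = p (\<lambda>i. y i - x i)" by (subst (asm) scale) simp
  next
    fix x :: "'i \<Rightarrow> real"
    have "p (\<lambda>i. x i - x i) = p (\<lambda>i. 0 * x i)" by (rule local) auto
    then show "p (\<lambda>i. x i - x i) \<le> \<eta>" using \<eta> by (subst (asm) scale) simp
  qed blast
  moreover have "real (nat \<lfloor>(1 + 2 * r / \<eta>) ^ card I\<rfloor>) \<le> (1 + 2 * r / \<eta>) ^ card I"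
    using \<eta> r by (intro of_nat_floor) auto
  ultimately show thesis using that by (meson of_nat_mono order_trans)
qed

end

lemma nn_integral_gaussian:
  assumes "0 < s"
  shows "(\<integral>\<^sup>+x. ennreal (exp (- (s * (x - a)\<^sup>2))) \<partial>lborel) = ennreal (sqrt (pi / s))"
proof -
  \<comment> \<open>The standard deviation for which the exponent of the normal density is -s (x -
    a)^2.\<close>
  define g where "g = sqrt (1 / (2 * s))"
  have g: "g > 0" "g\<^sup>2 = 1 / (2 * s)" using assms by (auto simp: g_def)
  have "exp (- (s * (x - a)\<^sup>2)) = sqrt (pi / s) * normal_density a g x" for x
    using assms by (simp add: normal_density_def g)
  then have "(\<integral>\<^sup>+x. ennreal (exp (- (s * (x - a)\<^sup>2))) \<partial>lborel)
     = ennreal (sqrt (pi / s)) * (\<integral>\<^sup>+x. ennreal (normal_density a g x) \<partial>lborel)"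
    using assms by (simp add: ennreal_mult nn_integral_cmult)
  also have "(\<integral>\<^sup>+x. ennreal (normal_density a g x) \<partial>lborel) = 1"
    using g by (subst nn_integral_eq_integral) auto
  finally show ?thesis by simp
qed

text \<open>The indicator of the ball is dominated by $e^{s r^2} \prod_i e^{-s (t_i - a_i)^2}$; the choice
  $s = d / (2 r^2)$ is optimal.\<close>

lemma emeasure_euclidean_ball_le:
  fixes a :: "'i \<Rightarrow> real"
  assumes I: "finite I" "I \<noteq> {}" and r: "0 < r"
    and B: "\<And>t. t \<in> B \<Longrightarrow> t \<in> space (leb I) \<and> L2_set (\<lambda>i. t i - a i) I \<le> r"
  shows "emeasure (leb I) B \<le> ennreal (sqrt (2 * pi * exp 1 * r\<^sup>2 / card I) ^ card I)"
proof -
  define d where "d = card I"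
  have d: "d > 0" using I by (simp add: d_def card_gt_0_iff)
  define s where "s = d / (2 * r\<^sup>2)"
  have s: "s > 0" using d r by (simp add: s_def)
  have *: "indicator B t \<le> ennreal (exp (s * r\<^sup>2)) * (\<Prod>i\<in>I. ennreal (exp (- (s * (t i - a i)\<^sup>2))))"
    for t :: "'i \<Rightarrow> real"
  proof (cases "t \<in> B")
    case True
    have "(L2_set (\<lambda>i. t i - a i) I)\<^sup>2 \<le> r\<^sup>2" using B[OF True] by (intro power_mono) auto
    then have "0 \<le> s * (r\<^sup>2 - (\<Sum>i\<in>I. (t i - a i)\<^sup>2))" using s by (simp add: L2_set_power2)
    then have "1 \<le> exp (s * r\<^sup>2 + (\<Sum>i\<in>I. - (s * (t i - a i)\<^sup>2)))"
      by (simp add: sum_negf sum_distrib_left right_diff_distrib)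
    also have "\<dots> = exp (s * r\<^sup>2) * (\<Prod>i\<in>I. exp (- (s * (t i - a i)\<^sup>2)))"
      using I by (simp add: exp_add exp_sum)
    finally show ?thesis
      using True by (simp add: prod_ennreal ennreal_mult[symmetric] prod_nonneg)
  qed auto
  have "emeasure (leb I) B \<le> (\<integral>\<^sup>+t. indicator B t \<partial>leb I)"
  \<comment> \<open>A set outside the \<sigma>-algebra has \<open>emeasure\<close> 0 by convention,
    so the estimate holds for it as well.\<close>
  proof (cases "B \<in> sets (leb I)")
    case False
    then show ?thesis by (simp add: emeasure_notin_sets)
  qed simp
  also have "\<dots> \<le> (\<integral>\<^sup>+t. ennreal (exp (s * r\<^sup>2)) * (\<Prod>i\<in>I. ennreal (exp (- (s * (t i - a i)\<^sup>2)))) \<partial>leb I)"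
    by (intro nn_integral_mono *)
  also have "\<dots> = ennreal (exp (s * r\<^sup>2)) * (\<integral>\<^sup>+t. (\<Prod>i\<in>I. ennreal (exp (- (s * (t i - a i)\<^sup>2)))) \<partial>leb I)"
    by (rule nn_integral_cmult) measurable
  also have "(\<integral>\<^sup>+t. (\<Prod>i\<in>I. ennreal (exp (- (s * (t i - a i)\<^sup>2)))) \<partial>leb I)
     = (\<Prod>i\<in>I. \<integral>\<^sup>+x. ennreal (exp (- (s * (x - a i)\<^sup>2))) \<partial>lborel)"
    by (rule leb.product_nn_integral_prod[OF I(1), of "\<lambda>i x. ennreal (exp (- (s * (x - a i)\<^sup>2)))"]) measurable
  also have "\<dots> = ennreal (sqrt (pi / s) ^ d)"
    using s by (simp add: nn_integral_gaussian d_def ennreal_power)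
  also have "ennreal (exp (s * r\<^sup>2)) * ennreal (sqrt (pi / s) ^ d) = ennreal ((sqrt (exp 1) * sqrt (pi / s)) ^ d)"
  proof -
    \<comment> \<open>By the choice of s, s r^2 = d / 2, so this factor is shared equally by the d
      coordinates.\<close>
    have "exp (s * r\<^sup>2) = exp (1 / 2) ^ d" using r by (simp add: s_def exp_of_nat_mult[symmetric])
    also have "exp (1 / 2 :: real) = sqrt (exp 1)"
      by (rule real_sqrt_unique[symmetric]) (auto simp: exp_double[symmetric])
    finally show ?thesis using s by (simp add: ennreal_mult[symmetric] power_mult_distrib)
  qed
  also have "sqrt (exp 1) * sqrt (pi / s) = sqrt (2 * pi * exp 1 * r\<^sup>2 / card I)"
    using d r by (simp add: s_def d_def real_sqrt_mult[symmetric] mult_ac)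
  finally show ?thesis by (simp add: d_def)
qed

text \<open>On a countable index type the Borel sets of the product topology are generated by the
  coordinates, so it suffices that each coordinate is measurable for \<open>leb I\<close>.\<close>

lemma borel_measurable_leb_if_closed:
  fixes p :: "('i::countable \<Rightarrow> real) \<Rightarrow> real"
  assumes "\<And>r. closed {t. p t \<le> r}"
  shows "p \<in> borel_measurable (leb I)"
proof -
  have "p \<in> borel_measurable borel"
    using assms by (intro borel_measurable_iff_le[THEN iffD2]) auto
  moreover have "(\<lambda>t. t) \<in> measurable (leb I) (borel :: ('i \<Rightarrow> real) measure)"
    unfolding sets_PiM_equal_borel[symmetric, THEN measurable_cong_sets[OF refl]]
  proof (rule measurable_PiM_single')
    fix i :: 'i
    show "(\<lambda>t. t i) \<in> borel_measurable (leb I)"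
    proof (cases "i \<in> I")
      \<comment> \<open>Points of \<open>space (leb I)\<close> take the fixed value
        \<open>undefined\<close> off I, so these coordinates are constant.\<close>
      case False
      then have "(\<lambda>t. t i) \<in> borel_measurable (leb I) \<longleftrightarrow> (\<lambda>t. undefined :: real) \<in> borel_measurable (leb I)"
        by (intro measurable_cong) (auto simp: space_PiM PiE_iff extensional_def)
      then show ?thesis by simp
    qed measurable
  qed auto
  ultimately show ?thesis using measurable_compose by blast
qed

text \<open>For r \<ge> 0 the bound on the norm is a conjunction of conditions, one for each vector,
  each closed by continuity of the entries. For negative r the set is empty.\<close>

lemma op_norm_closed:
  fixes A :: "('i \<Rightarrow> real) \<Rightarrow> complex mat"
  assumes A: "\<And>t. A t \<in> carrier_mat k k"
    and cont: "\<And>i j. i < k \<Longrightarrow> j < k \<Longrightarrow> continuous_on UNIV (\<lambda>t. A t $$ (i, j))"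
  shows "closed {t. mat_op_norm (A t) \<le> r}"
proof (cases "0 \<le> r")
  case True
  have [simp]: "dim_row (A t) = k" "dim_col (A t) = k" for t using A[of t] by auto
  have "{t. mat_op_norm (A t) \<le> r} = (\<Inter>v\<in>carrier_vec k. {t. cvec_norm (A t *\<^sub>v v) \<le> r * cvec_norm v})"
  proof (intro equalityI subsetI)
    fix t assume "t \<in> {t. mat_op_norm (A t) \<le> r}"
    then show "t \<in> (\<Inter>v\<in>carrier_vec k. {t. cvec_norm (A t *\<^sub>v v) \<le> r * cvec_norm v})"
      by (auto intro!: order_trans[OF cvec_norm_mult_le[OF A] mult_right_mono])
  next
    fix t assume "t \<in> (\<Inter>v\<in>carrier_vec k. {t. cvec_norm (A t *\<^sub>v v) \<le> r * cvec_norm v})"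
    then show "t \<in> {t. mat_op_norm (A t) \<le> r}"
      using True by (auto intro!: mat_op_norm_le)
  qed
  moreover have "closed {t. cvec_norm (A t *\<^sub>v v) \<le> r * cvec_norm v}" if v: "v \<in> carrier_vec k" for v
  proof (rule closed_Collect_le)
    have "continuous_on UNIV (\<lambda>t. (A t *\<^sub>v v) $ i)" if "i < k" for i
      using that v by (auto simp: scalar_prod_def intro!: continuous_intros cont)
    then show "continuous_on UNIV (\<lambda>t. cvec_norm (A t *\<^sub>v v))"
      unfolding cvec_norm_L2 L2_set_def by (auto intro!: continuous_intros)
  qed simp
  ultimately show ?thesis by auto
next
  case False
  then have "\<not> mat_op_norm (A t) \<le> r" for t using mat_op_norm_nonneg[of "A t"] by linarith
  then show ?thesis by simp
qed

lemma continuous_herm: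
  assumes "i < k" "j < k"
  shows "continuous_on UNIV (\<lambda>t. herm k (\<lambda>p. t (f p)) $$ (i, j))"
  using assms unfolding herm_def Complex_eq
  by (cases "i < j"; cases "i = j") (auto intro!: continuous_intros)

text \<open>Common verification for the two coordinate systems \<open>herm\<close> and
  \<open>cartesian_mat\<close>. The factors 2 in \<open>upper\<close> and \<open>lower\<close> are
  generous enough for both.\<close>

lemma coord_norm_mat_op_norm:
  fixes A :: "('i::countable \<Rightarrow> real) \<Rightarrow> complex mat"
  assumes "finite I" and A: "\<And>t. A t \<in> carrier_mat k k"
    and local: "\<And>s t. (\<And>i. i \<in> I \<Longrightarrow> s i = t i) \<Longrightarrow> A s = A t"
    and scale: "\<And>c t. A (\<lambda>i. c * t i) = complex_of_real c \<cdot>\<^sub>m A t"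
    and add: "\<And>s t. A (\<lambda>i. s i + t i) = A s + A t"
    and cont: "\<And>i j. i < k \<Longrightarrow> j < k \<Longrightarrow> continuous_on UNIV (\<lambda>t. A t $$ (i, j))"
    and upper: "\<And>t \<delta> i j. (\<And>i. i \<in> I \<Longrightarrow> \<bar>t i\<bar> < \<delta>) \<Longrightarrow> i < k \<Longrightarrow> j < k \<Longrightarrow> cmod (A t $$ (i, j)) \<le> 2 * \<delta>"
    and lower: "\<And>t i. i \<in> I \<Longrightarrow> \<bar>t i\<bar> \<le> 2 * mat_op_norm (A t)"
  shows "coord_norm I (\<lambda>t. mat_op_norm (A t))"
proof
  have dim [simp]: "dim_row (A t) = k" "dim_col (A t) = k" for t using A[of t] by auto
  show "finite I" by fact
  show "mat_op_norm (A s) = mat_op_norm (A t)" if "\<And>i. i \<in> I \<Longrightarrow> s i = t i" for s t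
    using local[OF that] by simp
  show "mat_op_norm (A (\<lambda>i. c * t i)) = \<bar>c\<bar> * mat_op_norm (A t)" for c t
  proof (cases "c = 0")
    case True
    then show ?thesis
      using mat_op_norm_smult[of "complex_of_real c" "A t"] mat_op_norm_nonneg[of "0 \<cdot>\<^sub>m A t"]
      unfolding scale by (simp add: True)
  next
    case False
    \<comment> \<open>The reverse inequality is \<open>mat_op_norm_smult\<close> for the scalar 1 /
      c.\<close>
    then have "mat_op_norm (A t) \<le> \<bar>1 / c\<bar> * mat_op_norm (A (\<lambda>i. c * t i))"
      using mat_op_norm_smult[of "complex_of_real (1 / c)" "A (\<lambda>i. c * t i)"] scale[of "1 / c" "\<lambda>i. c * t i"]
      by (simp add: norm_divide)
    then have "\<bar>c\<bar> * mat_op_norm (A t) \<le> mat_op_norm (A (\<lambda>i. c * t i))"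
      using False by (simp add: abs_divide field_simps)
    then show ?thesis using mat_op_norm_smult[of "complex_of_real c" "A t"] by (simp add: scale)
  qed
  show "mat_op_norm (A (\<lambda>i. s i + t i)) \<le> mat_op_norm (A s) + mat_op_norm (A t)" for s t
    unfolding add by (rule mat_op_norm_triangle[OF A A])
  show "(\<lambda>t. mat_op_norm (A t)) \<in> borel_measurable (leb I)"
    by (intro borel_measurable_leb_if_closed op_norm_closed[OF A] cont)
  show "\<exists>a>0. \<forall>t. (\<forall>i\<in>I. \<bar>t i\<bar> < a) \<longrightarrow> mat_op_norm (A t) < 1"
  proof (intro exI conjI allI impI)
    \<comment> \<open>The norm is at most the sum of the moduli of k^2 entries, each at most 2
      \<delta>; the summand 1 in the denominator makes the total strictly less than 1 and covers k =
      0.\<close>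
    define \<delta> where "\<delta> = 1 / (2 * (real k)\<^sup>2 + 1)"
    show "0 < 1 / (2 * (real k)\<^sup>2 + 1)" by (simp add: add_nonneg_pos)
    fix t :: "'i \<Rightarrow> real" assume t: "\<forall>i\<in>I. \<bar>t i\<bar> < 1 / (2 * (real k)\<^sup>2 + 1)"
    have "mat_op_norm (A t) \<le> (\<Sum>i<k. \<Sum>j<k. cmod (A t $$ (i, j)))"
      using mat_op_norm_le_entry_sum[of "A t"] by (simp add: entry_sum_def)
    also have "\<dots> \<le> (\<Sum>i<k. \<Sum>j<k. 2 * \<delta>)"
      by (intro sum_mono upper) (use t \<delta>_def in auto)
    also have "\<dots> = 2 * (real k)\<^sup>2 / (2 * (real k)\<^sup>2 + 1)" by (simp add: power2_eq_square \<delta>_def)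
    also have "\<dots> < 1" by (simp add: divide_less_eq add_pos_nonneg add_nonneg_pos)
    finally show "mat_op_norm (A t) < 1" .
  qed
  show "\<exists>b. \<forall>t. mat_op_norm (A t) < 1 \<longrightarrow> (\<forall>i\<in>I. \<bar>t i\<bar> \<le> b)"
  proof (intro exI[of _ 2] allI impI ballI)
    fix t i assume "mat_op_norm (A t) < 1" "i \<in> I"
    then show "\<bar>t i\<bar> \<le> 2" using lower[of i t] by linarith
  qed
qed

lemma coord_norm_herm: "coord_norm ({..<k} \<times> {..<k}) (\<lambda>u. mat_op_norm (herm k u))"
proof (rule coord_norm_mat_op_norm[of _ _ k])
  show "continuous_on UNIV (\<lambda>t. herm k t $$ (i, j))" if "i < k" "j < k" for i j
    using continuous_herm[OF that, of "\<lambda>p. p"] .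
  show "cmod (herm k t $$ (i, j)) \<le> 2 * \<delta>"
    if "\<And>i. i \<in> {..<k} \<times> {..<k} \<Longrightarrow> \<bar>t i\<bar> < \<delta>" "i < k" "j < k" for t \<delta> i j
    using index_herm_le[of i k j t] that(1)[of "(i, j)"] that(1)[of "(j, i)"] that(2,3) by simp
  show "\<bar>t p\<bar> \<le> 2 * mat_op_norm (herm k t)" if "p \<in> {..<k} \<times> {..<k}" for t p
  proof -
    obtain i j where p: "p = (i, j)" "i < k" "j < k" using \<open>p \<in> _\<close> by auto
    have "\<bar>t p\<bar> \<le> sqrt 2 * cmod (herm k t $$ (i, j))"
      using coord_le_index_herm[of i k j t] p by simp
    also have "\<dots> \<le> 2 * mat_op_norm (herm k t)"
      using p by (intro mult_mono index_le_mat_op_norm[of _ k k] real_le_lsqrt) auto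
    finally show ?thesis .
  qed
qed (auto simp: herm_add herm_smult intro!: eq_matI, auto simp: herm_def)

text \<open>All complex matrices in 2 k^2 real coordinates, \<open>False\<close> for real and
  \<open>True\<close> for imaginary parts. It serves the coarse net, where the doubled dimension is
  harmless.\<close>

definition cartesian_mat :: "nat \<Rightarrow> (bool \<times> nat \<times> nat \<Rightarrow> real) \<Rightarrow> complex mat" where
  "cartesian_mat k t = Matrix.mat k k (\<lambda>(i, j). Complex (t (False, i, j)) (t (True, i, j)))"

lemma cartesian_mat_carrier [simp]:
  "cartesian_mat k t \<in> carrier_mat k k" "dim_row (cartesian_mat k t) = k" "dim_col (cartesian_mat k t) = k"
  by (auto simp: cartesian_mat_def)

lemma cartesian_mat_minus: "cartesian_mat k s - cartesian_mat k t = cartesian_mat k (\<lambda>i. s i - t i)"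
  by (rule eq_matI) (auto simp: cartesian_mat_def complex_eq_iff)

lemma cartesian_mat_smult: "complex_of_real c \<cdot>\<^sub>m cartesian_mat k t = cartesian_mat k (\<lambda>i. c * t i)"
  by (rule eq_matI) (auto simp: cartesian_mat_def complex_eq_iff)

lemma cartesian_mat_add: "cartesian_mat k s + cartesian_mat k t = cartesian_mat k (\<lambda>i. s i + t i)"
  by (rule eq_matI) (auto simp: cartesian_mat_def complex_eq_iff)

lemma cartesian_matE:
  assumes "A \<in> carrier_mat k k"
  obtains t where "A = cartesian_mat k t"
proof
  show "A = cartesian_mat k (\<lambda>(b, i, j). if b then Im (A $$ (i, j)) else Re (A $$ (i, j)))"
    using assms by (intro eq_matI) (auto simp: cartesian_mat_def)
qed

lemma coord_norm_cartesian: "coord_norm (UNIV \<times> {..<k} \<times> {..<k}) (\<lambda>u. mat_op_norm (cartesian_mat k u))"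
proof (rule coord_norm_mat_op_norm[of _ _ k])
  show "continuous_on UNIV (\<lambda>t. cartesian_mat k t $$ (i, j))" if "i < k" "j < k" for i j
    using that unfolding cartesian_mat_def Complex_eq by (auto intro!: continuous_intros)
  show "cmod (cartesian_mat k t $$ (i, j)) \<le> 2 * \<delta>"
    if "\<And>i. i \<in> UNIV \<times> {..<k} \<times> {..<k} \<Longrightarrow> \<bar>t i\<bar> < \<delta>" "i < k" "j < k" for t \<delta> i j
    using that(1)[of "(True, i, j)"] that(1)[of "(False, i, j)"] that(2,3)
      cmod_le[of "Complex (t (False, i, j)) (t (True, i, j))"] by (simp add: cartesian_mat_def)
  show "\<bar>t p\<bar> \<le> 2 * mat_op_norm (cartesian_mat k t)" if "p \<in> UNIV \<times> {..<k} \<times> {..<k}" for t p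
  proof -
    obtain c i j where p: "p = (c, i, j)" "i < k" "j < k" using \<open>p \<in> _\<close> by auto
    have "\<bar>t p\<bar> \<le> cmod (cartesian_mat k t $$ (i, j))"
      using p abs_Re_le_cmod[of "cartesian_mat k t $$ (i, j)"] abs_Im_le_cmod[of "cartesian_mat k t $$ (i, j)"]
      by (cases c) (auto simp: cartesian_mat_def)
    also have "\<dots> \<le> mat_op_norm (cartesian_mat k t)"
      using p by (intro index_le_mat_op_norm[of _ k k]) auto
    finally show ?thesis using mat_op_norm_nonneg[of "cartesian_mat k t"] by linarith
  qed
qed (auto simp: cartesian_mat_add cartesian_mat_smult intro!: eq_matI, auto simp: cartesian_mat_def)


section \<open>Nets in the unitary group\<close>

text \<open>If $X = V - 1$, then $X + X^* = - X^* X$. So the self-adjoint part of $X$ is of second order, and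
  near $1$ a unitary depends in a Lipschitz way on its skew-adjoint part, which has only $k^2$ real
  coordinates.\<close>

lemma unitary_diff_le:
  assumes V: "V \<in> unitary_group k" "mat_op_norm (V - 1\<^sub>m k) \<le> 1 / 4"
      "V - mat_adjoint V = (2 * \<i>) \<cdot>\<^sub>m herm k u"
    and W: "W \<in> unitary_group k" "mat_op_norm (W - 1\<^sub>m k) \<le> 1 / 4"
      "W - mat_adjoint W = (2 * \<i>) \<cdot>\<^sub>m herm k v"
  shows "mat_op_norm (V - W) \<le> 4 / 3 * mat_op_norm (herm k (\<lambda>p. u p - v p))"
proof -
  note Vc = unitary_group_carrier[OF V(1)] and Wc = unitary_group_carrier[OF W(1)]
  note Va = adjoint_carrier[OF Vc] and Wa = adjoint_carrier[OF Wc]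
  have [simp]: "dim_row V = k" "dim_col V = k" "dim_row W = k" "dim_col W = k"
    using Vc Wc by auto
  have VW: "mat_adjoint V * V = 1\<^sub>m k" "mat_adjoint W * W = 1\<^sub>m k"
    using V W by (auto simp: unitary_group_def)
  \<comment> \<open>The mixed term Z cancels when \<open>P\<close> and \<open>Q\<close> are added,
    which leaves -(V - W) - (V - W)*. This is the identity X + X* = -X* X with its analogue for Y
    subtracted.\<close>
  define Z where "Z = mat_adjoint V * W"
  have Z: "Z \<in> carrier_mat k k" unfolding Z_def using Va Wc by (rule mult_carrier_mat)
  then have [simp]: "dim_row Z = k" "dim_col Z = k" by auto
  define X where "X = V - 1\<^sub>m k"
  define Y where "Y = W - 1\<^sub>m k"
  have X: "X \<in> carrier_mat k k" and Y: "Y \<in> carrier_mat k k" and D: "V - W \<in> carrier_mat k k"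
    unfolding X_def Y_def by (simp_all add: minus_carrier_mat Wc)
  have P: "mat_adjoint X * (V - W) = 1\<^sub>m k - Z - (V - W)"
  proof -
    have "mat_adjoint X = mat_adjoint V - 1\<^sub>m k"
      unfolding X_def using adjoint_minus[OF Vc one_carrier_mat] by simp
    then show ?thesis
      using minus_mult_distrib_mat[OF Va one_carrier_mat D] mult_minus_distrib_mat[OF Va Vc Wc] VW D
      by (simp add: Z_def)
  qed
  have Q: "mat_adjoint (V - W) * Y = (Z - 1\<^sub>m k) - (mat_adjoint V - mat_adjoint W)"
    using mult_minus_distrib_mat[OF adjoint_carrier[OF D] Wc one_carrier_mat]
      minus_mult_distrib_mat[OF Va Wa Wc] adjoint_minus[OF Vc Wc] VW
      right_mult_one_mat[OF adjoint_carrier[OF D]]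
    by (simp add: Z_def Y_def)
  have Pc: "mat_adjoint X * (V - W) \<in> carrier_mat k k" and Qc: "mat_adjoint (V - W) * Y \<in> carrier_mat k k"
    using mult_carrier_mat[OF adjoint_carrier[OF X] D] mult_carrier_mat[OF adjoint_carrier[OF D] Y] by auto
  \<comment> \<open>The skew-adjoint part of V - W plus its self-adjoint part; the latter is written
    through products with the small matrices X and Y.\<close>
  have "V - W = (1 / 2) \<cdot>\<^sub>m ((V - mat_adjoint V) - (W - mat_adjoint W))
      + (- (1 / 2)) \<cdot>\<^sub>m (mat_adjoint X * (V - W) + mat_adjoint (V - W) * Y)"
    unfolding P Q by (rule eq_matI) (auto simp: field_simps)
  also have "(V - mat_adjoint V) - (W - mat_adjoint W) = (2 * \<i>) \<cdot>\<^sub>m herm k (\<lambda>p. u p - v p)"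
    unfolding V(3) W(3) herm_minus[symmetric] by (rule eq_matI) (auto simp: algebra_simps)
  finally have eq: "V - W = (1 / 2) \<cdot>\<^sub>m ((2 * \<i>) \<cdot>\<^sub>m herm k (\<lambda>p. u p - v p))
      + (- (1 / 2)) \<cdot>\<^sub>m (mat_adjoint X * (V - W) + mat_adjoint (V - W) * Y)" .
  have X4: "mat_op_norm X \<le> 1 / 4" and Y4: "mat_op_norm Y \<le> 1 / 4"
    using V(2) W(2) by (auto simp: X_def Y_def)
  have "mat_op_norm (mat_adjoint X * (V - W)) \<le> 1 / 4 * mat_op_norm (V - W)"
    using mat_op_norm_mult[OF adjoint_carrier[OF X] D] mult_right_mono[OF X4, of "mat_op_norm (V - W)"]
    by (simp add: mat_op_norm_adjoint[OF X])
  moreover have "mat_op_norm (mat_adjoint (V - W) * Y) \<le> mat_op_norm (V - W) * (1 / 4)"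
    using mat_op_norm_mult[OF adjoint_carrier[OF D] Y] mult_left_mono[OF Y4, of "mat_op_norm (V - W)"]
    by (simp add: mat_op_norm_adjoint[OF D])
  ultimately have "mat_op_norm (mat_adjoint X * (V - W) + mat_adjoint (V - W) * Y) \<le> 1 / 2 * mat_op_norm (V - W)"
    using mat_op_norm_triangle[OF Pc Qc] by linarith
  then have "mat_op_norm ((- (1 / 2)) \<cdot>\<^sub>m (mat_adjoint X * (V - W) + mat_adjoint (V - W) * Y)) \<le> 1 / 4 * mat_op_norm (V - W)"
    using mat_op_norm_smult[of "- (1 / 2)" "mat_adjoint X * (V - W) + mat_adjoint (V - W) * Y"]
    by (simp add: norm_divide)
  moreover have "mat_op_norm ((1 / 2) \<cdot>\<^sub>m ((2 * \<i>) \<cdot>\<^sub>m herm k (\<lambda>p. u p - v p))) \<le> mat_op_norm (herm k (\<lambda>p. u p - v p))"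
    using mat_op_norm_smult[of "1 / 2" "(2 * \<i>) \<cdot>\<^sub>m herm k (\<lambda>p. u p - v p)"]
      mat_op_norm_smult[of "2 * \<i>" "herm k (\<lambda>p. u p - v p)"]
    by (simp add: norm_mult norm_divide)
  moreover have "mat_op_norm (V - W) \<le> mat_op_norm ((1 / 2) \<cdot>\<^sub>m ((2 * \<i>) \<cdot>\<^sub>m herm k (\<lambda>p. u p - v p)))
     + mat_op_norm ((- (1 / 2)) \<cdot>\<^sub>m (mat_adjoint X * (V - W) + mat_adjoint (V - W) * Y))"
    by (subst eq, rule mat_op_norm_triangle[of _ k k]) (use add_carrier_mat[OF Qc] in auto)
  \<comment> \<open>The self-adjoint part has at most a quarter of the norm of V - W; moving it to
    the left gives the factor 4/3 = 1 / (1 - 1/4).\<close>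
  ultimately show ?thesis by linarith
qed

text \<open>Packing in all 2 k^2 real coordinates gives 9^(2 k^2), where 9 = 1 + 2 / (1/4). At this
  fixed scale the loss in the exponent is a factor that does not involve \<epsilon>.\<close>

lemma unitary_coarse_net:
  obtains G where "finite G" "G \<subseteq> unitary_group k" "real (card G) \<le> 81 ^ (k * k)"
    "\<And>U. U \<in> unitary_group k \<Longrightarrow> \<exists>W\<in>G. mat_op_norm (U - W) \<le> 1 / 4"
proof -
  interpret coord_norm "UNIV \<times> {..<k} \<times> {..<k}" "\<lambda>u. mat_op_norm (cartesian_mat k u)"
    by (rule coord_norm_cartesian)
  obtain F where F: "finite F" "F \<subseteq> {t. cartesian_mat k t \<in> unitary_group k}"
    "real (card F) \<le> (1 + 2 * 1 / (1 / 4)) ^ card ((UNIV :: bool set) \<times> {..<k} \<times> {..<k})"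
    "\<And>s. s \<in> {t. cartesian_mat k t \<in> unitary_group k} \<Longrightarrow> \<exists>f\<in>F. mat_op_norm (cartesian_mat k (\<lambda>i. s i - f i)) \<le> 1 / 4"
    using net[of "{t. cartesian_mat k t \<in> unitary_group k}" 1 "1 / 4"] mat_op_norm_unitary by auto
  show thesis
  proof
    show "finite (cartesian_mat k ` F)" using F by simp
    show "cartesian_mat k ` F \<subseteq> unitary_group k" using F by auto
    have "real (card (cartesian_mat k ` F)) \<le> real (card F)" using F card_image_le by simp
    also have "\<dots> \<le> 9 ^ (2 * (k * k))" using F(3) by (simp add: card_cartesian_product)
    also have "\<dots> = 81 ^ (k * k)" by (simp add: power_mult)
    finally show "real (card (cartesian_mat k ` F)) \<le> 81 ^ (k * k)" .
    fix U assume U: "U \<in> unitary_group k"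
    then obtain t where t: "U = cartesian_mat k t" using cartesian_matE unitary_group_carrier by metis
    then obtain f where "f \<in> F" "mat_op_norm (cartesian_mat k (\<lambda>i. t i - f i)) \<le> 1 / 4"
      using F(4)[of t] U by auto
    then show "\<exists>W\<in>cartesian_mat k ` F. mat_op_norm (U - W) \<le> 1 / 4"
      by (auto simp: t cartesian_mat_minus)
  qed
qed

lemma unitary_skew_part:
  assumes V: "V \<in> unitary_group k"
  obtains u where "V - mat_adjoint V = (2 * \<i>) \<cdot>\<^sub>m herm k u" "mat_op_norm (herm k u) \<le> 1"
proof -
  note c = unitary_group_carrier[OF V]
  have [simp]: "dim_row V = k" "dim_col V = k" using c by auto
  \<comment> \<open>The imaginary part of V, that is V - V* divided by 2 i; it is self-adjoint, so
    \<open>hermE\<close> supplies coordinates.\<close>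
  define H where "H = (- (\<i> / 2)) \<cdot>\<^sub>m (V - mat_adjoint V)"
  have H: "H \<in> carrier_mat k k" using c by (auto simp: H_def)
  have "mat_adjoint H = H" unfolding H_def by (rule eq_matI) (auto simp: algebra_simps)
  with H obtain u where u: "H = herm k u" by (rule hermE)
  show thesis
  proof
    show "V - mat_adjoint V = (2 * \<i>) \<cdot>\<^sub>m herm k u"
      unfolding u[symmetric] H_def by (rule eq_matI) auto
    have "V - mat_adjoint V = V + (-1) \<cdot>\<^sub>m mat_adjoint V" by (rule eq_matI) auto
    then have "mat_op_norm (V - mat_adjoint V) \<le> 1 + 1"
      using mat_op_norm_triangle[of V k k "(-1) \<cdot>\<^sub>m mat_adjoint V"] mat_op_norm_smult[of "-1" "mat_adjoint V"]
        mat_op_norm_unitary[OF V] mat_op_norm_unitary[OF unitary_group_adjoint[OF V]] c by simp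
    then show "mat_op_norm (herm k u) \<le> 1"
      unfolding u[symmetric] H_def using mat_op_norm_smult[of "- (\<i> / 2)" "V - mat_adjoint V"]
      by (simp add: norm_divide)
  qed
qed

text \<open>A coarse net point U0 moves U to W = U0* U within 1/4 of the identity, and there
  \<open>unitary_diff_le\<close> makes W a Lipschitz function of k^2 coordinates. The constant 243
  is 81 * 3, as 1 + 2 / \<eta> \<le> 3 / \<eta>; the factor 2 rounds up the Lipschitz constant
  4/3.\<close>

lemma unitary_net:
  assumes \<eta>: "0 < \<eta>" "\<eta> \<le> 1"
  obtains G where "finite G" "G \<subseteq> unitary_group k" "real (card G) \<le> (243 / \<eta>) ^ (k * k)"
    "\<And>U. U \<in> unitary_group k \<Longrightarrow> \<exists>W\<in>G. mat_op_norm (U - W) \<le> 2 * \<eta>"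
proof -
  obtain G0 where G0: "finite G0" "G0 \<subseteq> unitary_group k" "real (card G0) \<le> 81 ^ (k * k)"
    "\<And>U. U \<in> unitary_group k \<Longrightarrow> \<exists>W\<in>G0. mat_op_norm (U - W) \<le> 1 / 4"
    using unitary_coarse_net by blast
  define R where "R u V \<longleftrightarrow> V \<in> unitary_group k \<and> mat_op_norm (V - 1\<^sub>m k) \<le> 1 / 4 \<and>
    V - mat_adjoint V = (2 * \<i>) \<cdot>\<^sub>m herm k u" for u V
  define S where "S = {u. mat_op_norm (herm k u) \<le> 1 \<and> (\<exists>V. R u V)}"
  interpret coord_norm "{..<k} \<times> {..<k}" "\<lambda>u. mat_op_norm (herm k u)"
    by (rule coord_norm_herm)
  obtain F where F: "finite F" "F \<subseteq> S"
    "real (card F) \<le> (1 + 2 * 1 / \<eta>) ^ card ({..<k} \<times> {..<k})"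
    "\<And>s. s \<in> S \<Longrightarrow> \<exists>f\<in>F. mat_op_norm (herm k (\<lambda>i. s i - f i)) \<le> \<eta>"
    using net[of S 1 \<eta>] \<eta> unfolding S_def by auto
  define V where "V u = (SOME V. R u V)" for u
  have V: "R u (V u)" if "u \<in> F" for u
    unfolding V_def by (rule someI_ex) (use that F(2) S_def in auto)
  show thesis
  proof
    let ?G = "(\<lambda>(U, u). U * V u) ` (G0 \<times> F)"
    show "finite ?G" using G0 F by simp
    show "?G \<subseteq> unitary_group k" using G0 V by (auto simp: R_def intro!: unitary_group_mult)
    have "real (card ?G) \<le> real (card G0) * real (card F)"
      using card_image_le[of "G0 \<times> F" "\<lambda>(U, u). U * V u"] G0 F
      by (simp add: card_cartesian_product flip: of_nat_mult)
    also have "\<dots> \<le> 81 ^ (k * k) * (1 + 2 / \<eta>) ^ (k * k)"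
      using G0(3) F(3) by (intro mult_mono) auto
    also have "\<dots> \<le> 81 ^ (k * k) * (3 / \<eta>) ^ (k * k)"
      using \<eta> by (intro mult_left_mono power_mono) (auto simp: field_simps)
    also have "\<dots> = (243 / \<eta>) ^ (k * k)"
      by (simp flip: power_mult_distrib)
    finally show "real (card ?G) \<le> (243 / \<eta>) ^ (k * k)" .
    fix U assume U: "U \<in> unitary_group k"
    obtain U0 where U0: "U0 \<in> G0" "mat_op_norm (U - U0) \<le> 1 / 4" using G0(4)[OF U] by blast
    have U0u: "U0 \<in> unitary_group k" using U0 G0 by auto
    note c = unitary_group_carrier[OF U] unitary_group_carrier[OF U0u]
    note a = unitary_group_adjoint[OF U0u]
    define W where "W = mat_adjoint U0 * U"
    have W: "W \<in> unitary_group k" unfolding W_def by (intro unitary_group_mult a U)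
    have UW: "U = U0 * W"
      using assoc_mult_mat[OF c(2) adjoint_carrier[OF c(2)] c(1)] U0u c by (simp add: W_def unitary_group_def)
    have "W - 1\<^sub>m k = mat_adjoint U0 * (U - U0)"
      using mult_minus_distrib_mat[OF adjoint_carrier[OF c(2)] c] U0u by (simp add: W_def unitary_group_def)
    then have "mat_op_norm (W - 1\<^sub>m k) \<le> mat_op_norm (mat_adjoint U0) * mat_op_norm (U - U0)"
      using mat_op_norm_mult[OF adjoint_carrier[OF c(2)], OF minus_carrier_mat[OF c(2)]] by simp
    also have "\<dots> \<le> 1 * (1 / 4)"
      using U0 mat_op_norm_unitary[OF a] by (intro mult_mono) auto
    finally have W1: "mat_op_norm (W - 1\<^sub>m k) \<le> 1 / 4" by simp
    obtain u where u: "W - mat_adjoint W = (2 * \<i>) \<cdot>\<^sub>m herm k u" "mat_op_norm (herm k u) \<le> 1"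
      using unitary_skew_part[OF W] .
    have "u \<in> S" using u W W1 by (auto simp: S_def R_def)
    then obtain f where f: "f \<in> F" "mat_op_norm (herm k (\<lambda>i. u i - f i)) \<le> \<eta>" using F(4) by blast
    have Vf: "V f \<in> unitary_group k" "mat_op_norm (V f - 1\<^sub>m k) \<le> 1 / 4"
      "V f - mat_adjoint (V f) = (2 * \<i>) \<cdot>\<^sub>m herm k f"
      using V[OF f(1)] by (auto simp: R_def)
    have "mat_op_norm (W - V f) \<le> 4 / 3 * mat_op_norm (herm k (\<lambda>p. u p - f p))"
      using unitary_diff_le[OF W W1 u(1) Vf] .
    then have WV: "mat_op_norm (W - V f) \<le> 2 * \<eta>" using f(2) \<eta> by linarith
    note d = unitary_group_carrier[OF W] unitary_group_carrier[OF Vf(1)]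
    have "U - U0 * V f = U0 * (W - V f)"
      unfolding UW using mult_minus_distrib_mat[OF c(2) d] by simp
    then have "mat_op_norm (U - U0 * V f) \<le> mat_op_norm U0 * mat_op_norm (W - V f)"
      using mat_op_norm_mult[OF c(2), OF minus_carrier_mat[OF d(2)]] by simp
    also have "\<dots> \<le> 1 * (2 * \<eta>)"
      using WV mat_op_norm_unitary[OF U0u] by (intro mult_mono) auto
    finally show "\<exists>W\<in>?G. mat_op_norm (U - W) \<le> 2 * \<eta>"
      using U0(1) f(1) by (intro bexI[of _ "U0 * V f"]) auto
  qed
qed


section \<open>Volumes and orbit covering numbers\<close>

text \<open>There is one ball for each pair of a covering centre D and a net unitary W. The bound on
  \<open>tuple_frob Bs\<close> passes to D and thus to the Lipschitz constant of W -> W D W*, which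
  keeps operator norms of the centres out of the estimate.\<close>

lemma sa_volume_le_cover:
  assumes n: "0 < n" and k: "0 < k" and \<epsilon>: "0 < \<epsilon>" "\<epsilon> < 1" and c: "0 \<le> c"
    and near: "\<And>As. As \<in> X \<Longrightarrow> \<exists>Bs\<in>\<Gamma> \<inter> mat_tuples n k.
      tuple_dist As Bs \<le> c * \<epsilon> * sqrt k \<and> tuple_frob Bs \<le> c * sqrt k"
    and F: "finite F" "F \<subseteq> mat_tuples n k" "\<Gamma> \<subseteq> (\<Union>Bs\<in>F. orbit_ball k \<epsilon> Bs)"
  shows "sa_volume n k X \<le> of_nat (card F) * ennreal ((243 / \<epsilon>) ^ (k * k) *
    (sqrt (200 * pi * exp 1 * (c + 1)\<^sup>2 / n) * \<epsilon> / sqrt k) ^ (n * (k * k)))"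
proof -
  define I where "I = {..<n} \<times> {..<k} \<times> {..<k}"
  have I: "finite I" "I \<noteq> {}" "card I = n * (k * k)" using n k by (auto simp: I_def card_cartesian_product)
  define sa where "sa = sa_tuple_of_coords n k"
  have sa: "sa t \<in> mat_tuples n k" for t unfolding sa_def by (rule sa_tuple_of_coords_in)
  \<comment> \<open>In units of \<epsilon> sqrt k, the steps from the given tuple to Bs, to U D U*
    and to W D W* have lengths at most c, 1 and 4 (c + 1), in total 5 (c + 1). The radius is twice
    that because the ball is recentred.\<close>
  define r where "r = 10 * (c + 1) * \<epsilon> * sqrt k"
  have r: "0 < r" using \<epsilon> k c by (simp add: r_def)
  obtain G where G: "finite G" "G \<subseteq> unitary_group k" "real (card G) \<le> (243 / \<epsilon>) ^ (k * k)"
    "\<And>U. U \<in> unitary_group k \<Longrightarrow> \<exists>W\<in>G. mat_op_norm (U - W) \<le> 2 * \<epsilon>"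
    using unitary_net[of \<epsilon> k] \<epsilon> by auto
  \<comment> \<open>W D W* need not be self-adjoint and may have no coordinates. The ball is
    therefore centred at the coordinates of some self-adjoint tuple within r / 2 of it, if there is
    one.\<close>
  define t0 where "t0 D W = (SOME t. tuple_dist (sa t) (conj_tuple W D) \<le> r / 2)" for D W
  define ball where "ball t = {s \<in> space (leb I). L2_set (\<lambda>i. s i - t i) I \<le> r}" for t
  have ball_sets: "ball t \<in> sets (leb I)" for t
    unfolding ball_def L2_set_def by measurable
  define b where "b = (sqrt (200 * pi * exp 1 * (c + 1)\<^sup>2 / n) * \<epsilon> / sqrt k) ^ (n * (k * k))"
  have ball_le: "emeasure (leb I) (ball t) \<le> ennreal b" for t
  proof -
    have "emeasure (leb I) (ball t) \<le> ennreal (sqrt (2 * pi * exp 1 * r\<^sup>2 / card I) ^ card I)"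
      by (rule emeasure_euclidean_ball_le[OF I(1,2) r, of _ t]) (auto simp: ball_def)
    \<comment> \<open>With r of order \<epsilon> sqrt k and dimension n k^2, the quotient r^2 / (n
      k^2) is of order \<epsilon>^2 / k; the constant 200 is 2 * 10^2.\<close>
    also have "2 * pi * exp 1 * r\<^sup>2 / card I = (200 * pi * exp 1 * (c + 1)\<^sup>2 / n) * (\<epsilon>\<^sup>2 / k)"
    proof -
      have "2 * pi * exp 1 * (100 * C * E * real k) / real (n * (k * k))
        = (200 * pi * exp 1 * C / real n) * (E / real k)" for C E :: real
        using k n by (simp add: field_simps)
      moreover have "r\<^sup>2 = 100 * (c + 1)\<^sup>2 * \<epsilon>\<^sup>2 * real k"
        unfolding r_def power_mult_distrib by simp
      ultimately show ?thesis by (simp only: I(3))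
    qed
    also have "sqrt \<dots> = sqrt (200 * pi * exp 1 * (c + 1)\<^sup>2 / n) * \<epsilon> / sqrt k"
      using \<epsilon> by (simp only: real_sqrt_mult real_sqrt_divide) simp
    finally show ?thesis by (simp only: b_def I(3))
  qed
  define T where "T = {t \<in> space (leb I). sa t \<in> X}"
  have "T \<subseteq> (\<Union>(D, W)\<in>F \<times> G. ball (t0 D W))"
  proof
    fix t assume "t \<in> T"
    then have t: "t \<in> space (leb I)" "sa t \<in> X" by (auto simp: T_def)
    obtain Bs where Bs: "Bs \<in> \<Gamma>" "Bs \<in> mat_tuples n k" "tuple_dist (sa t) Bs \<le> c * \<epsilon> * sqrt k"
      "tuple_frob Bs \<le> c * sqrt k"
      using near[OF t(2)] by auto
    obtain D where D: "D \<in> F" "Bs \<in> orbit_ball k \<epsilon> D" using F(3) Bs(1) by auto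
    have Dn: "D \<in> mat_tuples n k" using F D by auto
    obtain U where U: "U \<in> unitary_group k"
        "tuple_norm2 (map2 (\<lambda>A B. A - U * B * mat_adjoint U) Bs D) < \<epsilon>"
      using D(2) by (auto simp: orbit_ball_def)
    note Uc = unitary_group_carrier[OF U(1)]
    have UD: "tuple_dist Bs (conj_tuple U D) < \<epsilon> * sqrt k"
      using U(2) k by (simp add: tuple_norm2_orbit[OF Bs(2) Dn Uc] divide_less_eq)
    obtain W where W: "W \<in> G" "mat_op_norm (U - W) \<le> 2 * \<epsilon>" using G(4)[OF U(1)] by blast
    have Wu: "W \<in> unitary_group k" using W G by auto
    have UDn: "conj_tuple U D \<in> mat_tuples n k" and WDn: "conj_tuple W D \<in> mat_tuples n k"
      using conj_tuple_in[OF Uc Dn] conj_tuple_in[OF unitary_group_carrier[OF Wu] Dn] by auto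
    have "tuple_frob D \<le> c * sqrt k + \<epsilon> * sqrt k"
      using tuple_frob_le_orbit[OF U(1) Bs(2) Dn] UD Bs(4) by linarith
    also have "\<dots> \<le> (c + 1) * sqrt k"
      using \<epsilon> mult_right_mono[of \<epsilon> 1 "sqrt k"] by (simp add: distrib_right)
    finally have Df: "tuple_frob D \<le> (c + 1) * sqrt k" .
    have Dnn: "0 \<le> tuple_frob D" by (simp add: tuple_frob_def)
    have "tuple_dist (conj_tuple U D) (conj_tuple W D) \<le> 2 * mat_op_norm (U - W) * tuple_frob D"
      by (rule tuple_dist_conj[OF U(1) Wu Dn])
    also have "\<dots> \<le> 2 * (2 * \<epsilon>) * ((c + 1) * sqrt k)"
      using W(2) Df Dnn \<epsilon> by (intro mult_mono) auto
    finally have "tuple_dist (sa t) (conj_tuple W D) \<le> c * \<epsilon> * sqrt k + \<epsilon> * sqrt k + 2 * (2 * \<epsilon>) * ((c + 1) * sqrt k)"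
      using tuple_dist_triangle[OF sa Bs(2) WDn, of t] tuple_dist_triangle[OF Bs(2) UDn WDn] UD Bs(3)
      by linarith
    also have "\<dots> = r / 2" by (simp add: r_def algebra_simps)
    finally have 1: "tuple_dist (sa t) (conj_tuple W D) \<le> r / 2" .
    then have 2: "tuple_dist (sa (t0 D W)) (conj_tuple W D) \<le> r / 2"
      unfolding t0_def by (rule someI[where P = "\<lambda>t. tuple_dist (sa t) (conj_tuple W D) \<le> r / 2"])
    have "L2_set (\<lambda>i. t i - t0 D W i) I = tuple_dist (sa t) (sa (t0 D W))"
      unfolding sa_def I_def by (rule tuple_dist_sa_tuple_of_coords[symmetric])
    also have "\<dots> \<le> r"
      using tuple_dist_triangle[OF sa WDn sa, of t "t0 D W"] tuple_dist_commute[OF sa WDn, of "t0 D W"] 1 2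
      by linarith
    finally show "t \<in> (\<Union>(D, W)\<in>F \<times> G. ball (t0 D W))"
      using t D W by (auto simp: ball_def)
  qed
  \<comment> \<open>Monotonicity of \<open>emeasure\<close> asks for measurability of the union of
    balls; a non-measurable T counts as volume 0.\<close>
  then have "emeasure (leb I) T \<le> emeasure (leb I) (\<Union>(D, W)\<in>F \<times> G. ball (t0 D W))"
    by (rule emeasure_mono) (use F(1) G(1) ball_sets in auto)
  also have "\<dots> \<le> (\<Sum>(D, W)\<in>F \<times> G. emeasure (leb I) (ball (t0 D W)))"
    unfolding case_prod_beta
    by (rule emeasure_subadditive_finite) (use F(1) G(1) ball_sets in auto)
  also have "\<dots> \<le> (\<Sum>(D, W)\<in>F \<times> G. ennreal b)"
    unfolding case_prod_beta by (intro sum_mono ball_le)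
  also have "\<dots> = of_nat (card F) * (of_nat (card G) * ennreal b)"
    by (simp add: card_cartesian_product mult.assoc)
  also have "\<dots> \<le> of_nat (card F) * ennreal ((243 / \<epsilon>) ^ (k * k) * b)"
  proof (rule mult_left_mono)
    have b: "0 \<le> b" using \<epsilon> by (auto simp: b_def intro!: zero_le_power divide_nonneg_nonneg mult_nonneg_nonneg)
    have "of_nat (card G) * ennreal b = ennreal (real (card G) * b)"
      using b by (simp add: ennreal_mult ennreal_of_nat_eq_real_of_nat)
    also have "\<dots> \<le> ennreal ((243 / \<epsilon>) ^ (k * k) * b)"
      using b G(3) by (intro ennreal_leI mult_right_mono)
    finally show "of_nat (card G) * ennreal b \<le> ennreal ((243 / \<epsilon>) ^ (k * k) * b)" .
  qed simp
  finally show ?thesis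
    unfolding sa_volume_def Let_def T_def I_def sa_def b_def .
qed

text \<open>Division by the positive constant x turns the claim into a lower bound for an infimum,
  so single covers can be treated. Without a finite cover the infimum is infinite and the bound
  trivial.\<close>

lemma sa_volume_le_orbit_covering_number:
  assumes n: "0 < n" and k: "0 < k" and \<epsilon>: "0 < \<epsilon>" "\<epsilon> < 1" and c: "0 \<le> c"
    and \<Gamma>: "\<Gamma> \<subseteq> mat_tuples n k"
    and near: "\<And>As. As \<in> X \<Longrightarrow> \<exists>Bs\<in>\<Gamma>. tuple_dist As Bs \<le> c * \<epsilon> * sqrt k \<and> tuple_frob Bs \<le> c * sqrt k"
  shows "sa_volume n k X \<le> orbit_covering_number k \<Gamma> \<epsilon> * ennreal ((243 / \<epsilon>) ^ (k * k) *
    (sqrt (200 * pi * exp 1 * (c + 1)\<^sup>2 / n) * \<epsilon> / sqrt k) ^ (n * (k * k)))"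
proof (cases "\<Gamma> = {}")
  case True
  \<comment> \<open>\<open>near\<close> finds no candidates in an empty \<Gamma>, so the volume is
    0, which is compatible with the covering number 1 set by convention.\<close>
  then have "X = {}" using near by blast
  then show ?thesis by (simp add: sa_volume_def)
next
  case False
  define x where "x = (243 / \<epsilon>) ^ (k * k) *
    (sqrt (200 * pi * exp 1 * (c + 1)\<^sup>2 / n) * \<epsilon> / sqrt k) ^ (n * (k * k))"
  have x: "x > 0" unfolding x_def using n k \<epsilon> c by (intro mult_pos_pos zero_less_power divide_pos_pos) auto
  have "sa_volume n k X * ennreal (1 / x) \<le> orbit_covering_number k \<Gamma> \<epsilon>"
    unfolding orbit_covering_number_def if_not_P[OF False]
  proof (rule INF_greatest)
    fix F assume "F \<in> {F. finite F \<and> F \<subseteq> \<Gamma> \<and> \<Gamma> \<subseteq> (\<Union>Bs\<in>F. orbit_ball k \<epsilon> Bs)}"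
    then have "sa_volume n k X \<le> of_nat (card F) * ennreal x"
      unfolding x_def using \<Gamma> near by (intro sa_volume_le_cover[OF n k \<epsilon> c, of X \<Gamma>]) blast+
    then have "sa_volume n k X * ennreal (1 / x) \<le> of_nat (card F) * ennreal x * ennreal (1 / x)"
      by (rule mult_right_mono) simp
    also have "\<dots> = of_nat (card F) * (ennreal x * ennreal (1 / x))" by (rule mult.assoc)
    also have "ennreal x * ennreal (1 / x) = 1" using x by (simp flip: ennreal_mult)
    finally show "sa_volume n k X * ennreal (1 / x) \<le> of_nat (card F)" by simp
  qed
  then have "sa_volume n k X * ennreal (1 / x) * ennreal x \<le> orbit_covering_number k \<Gamma> \<epsilon> * ennreal x"
    by (rule mult_right_mono) simp
  also have "sa_volume n k X * ennreal (1 / x) * ennreal x = sa_volume n k X * (ennreal (1 / x) * ennreal x)"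
    by (rule mult.assoc)
  also have "ennreal (1 / x) * ennreal x = 1" using x by (simp flip: ennreal_mult)
  finally show ?thesis by (simp add: x_def)
qed

section \<open>Logarithms with values in the extended reals\<close>

lemma eln_mono: "x \<le> y \<Longrightarrow> eln x \<le> eln y"
proof (cases "x = 0 \<or> y = \<infinity>")
  case False
  assume "x \<le> y"
  with False have "x \<noteq> \<infinity>" "y \<noteq> 0" "0 < enn2real x" "enn2real x \<le> enn2real y"
    by (auto simp: top_unique enn2real_positive_iff less_top enn2real_mono zero_less_iff_neq_zero)
  then show ?thesis using False by (auto simp: eln_def)
qed (auto simp: eln_def)

lemma eln_mult_ennreal:
  assumes "0 < x"
  shows "eln (\<nu> * ennreal x) = eln \<nu> + ereal (ln x)"
proof (cases \<nu>)
  case (real r)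
  then show ?thesis using assms
    by (cases "r = 0") (auto simp: eln_def ln_mult ennreal_mult[symmetric] infinity_ennreal_def)
next
  case top
  then show ?thesis using assms by (auto simp: eln_def ennreal_top_mult infinity_ennreal_def)
qed

text \<open>After division by k^2, the unitary net contributes -ln \<epsilon> and the volume of a
  ball n ln \<epsilon>, whence the coefficient 1 - n. The power k^(-n k^2 / 2) in the volume cancels
  (n / 2) ln k on the left.\<close>

lemma eln_sa_volume_le:
  assumes n: "0 < n" and k: "0 < k" and \<epsilon>: "0 < \<epsilon>" "\<epsilon> < 1" and c: "0 \<le> c"
    and \<Gamma>: "\<Gamma> \<subseteq> mat_tuples n k"
    and near: "\<And>As. As \<in> X \<Longrightarrow> \<exists>Bs\<in>\<Gamma>. tuple_dist As Bs \<le> c * \<epsilon> * sqrt k \<and> tuple_frob Bs \<le> c * sqrt k"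
  shows "eln (sa_volume n k X) / ereal ((real k)\<^sup>2) + ereal (real n / 2 * ln (real k))
    \<le> ereal (- ln \<epsilon>) * (eln (orbit_covering_number k \<Gamma> \<epsilon>) / ereal (- (real k)\<^sup>2 * ln \<epsilon>))
      + ereal (ln 243 + real n / 2 * ln (200 * pi * exp 1 * (c + 1)\<^sup>2 / n) + (1 - real n) * - ln \<epsilon>)"
proof -
  define K where "K = 200 * pi * exp 1 * (c + 1)\<^sup>2 / n"
  have K: "K > 0" using n c by (auto simp: K_def intro!: divide_pos_pos mult_pos_pos)
  define x where "x = (243 / \<epsilon>) ^ (k * k) * (sqrt K * \<epsilon> / sqrt k) ^ (n * (k * k))"
  have x: "x > 0" unfolding x_def using n k \<epsilon> K by (intro mult_pos_pos zero_less_power divide_pos_pos) auto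
  define z where "z = ln 243 + real n / 2 * ln K + (1 - real n) * - ln \<epsilon>"
  have L: "- ln \<epsilon> > 0" using \<epsilon> by simp
  have "ln x = real (k * k) * ln (243 / \<epsilon>) + real (n * (k * k)) * ln (sqrt K * \<epsilon> / sqrt k)"
    unfolding x_def using k \<epsilon> K by (subst ln_mult_pos) (auto simp: ln_realpow)
  also have "ln (243 / \<epsilon>) = ln 243 - ln \<epsilon>" using \<epsilon> by (simp add: ln_div)
  also have "ln (sqrt K * \<epsilon> / sqrt k) = ln K / 2 + ln \<epsilon> - ln k / 2"
    using \<epsilon> K k by (simp add: ln_div ln_mult_pos ln_sqrt)
  also have "real (k * k) * (ln 243 - ln \<epsilon>) + real (n * (k * k)) * (ln K / 2 + ln \<epsilon> - ln k / 2)
     = (real k)\<^sup>2 * (z - real n / 2 * ln (real k))"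
    by (simp add: z_def power2_eq_square algebra_simps add_divide_distrib diff_divide_distrib)
  finally have lnx: "ln x = (real k)\<^sup>2 * (z - real n / 2 * ln (real k))" .
  have k2: "(real k)\<^sup>2 > 0" using k by simp
  have "sa_volume n k X \<le> orbit_covering_number k \<Gamma> \<epsilon> * ennreal x"
    unfolding x_def K_def by (rule sa_volume_le_orbit_covering_number[OF n k \<epsilon> c \<Gamma> near])
  then have "eln (sa_volume n k X) \<le> eln (orbit_covering_number k \<Gamma> \<epsilon>) + ereal (ln x)"
    using eln_mono eln_mult_ennreal[OF x] by metis
  then have "eln (sa_volume n k X) / ereal ((real k)\<^sup>2) + ereal (real n / 2 * ln (real k))
    \<le> (eln (orbit_covering_number k \<Gamma> \<epsilon>) + ereal (ln x)) / ereal ((real k)\<^sup>2) + ereal (real n / 2 * ln (real k))"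
    using k2 by (intro add_right_mono ereal_divide_right_mono) auto
  also have "\<dots> = ereal (- ln \<epsilon>) * (eln (orbit_covering_number k \<Gamma> \<epsilon>) / ereal (- (real k)\<^sup>2 * ln \<epsilon>)) + ereal z"
  proof (cases "eln (orbit_covering_number k \<Gamma> \<epsilon>)")
    case (real r)
    have "(r + ln x) / (real k)\<^sup>2 + real n / 2 * ln (real k) = - ln \<epsilon> * (r / (- (real k)\<^sup>2 * ln \<epsilon>)) + z"
      unfolding lnx using k2 L by (simp add: add_divide_distrib)
    moreover have "(real k)\<^sup>2 \<noteq> 0" "- (real k)\<^sup>2 * ln \<epsilon> \<noteq> 0" using k2 L by auto
    ultimately show ?thesis
      by (simp only: real plus_ereal.simps times_ereal.simps ereal_divide if_False)
  next
    \<comment> \<open>For an infinite logarithm both sides equal that same infinity, since the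
      divisors and the factor -ln \<epsilon> are positive.\<close>
    case PInf
    have "- (real k)\<^sup>2 * ln \<epsilon> > 0" using k2 L by (simp add: mult_pos_neg)
    then show ?thesis using k2 L by (simp add: PInf)
  next
    case MInf
    have "- (real k)\<^sup>2 * ln \<epsilon> > 0" using k2 L by (simp add: mult_pos_neg)
    then show ?thesis using k2 L by (simp add: MInf)
  qed
  finally show ?thesis by (simp add: z_def K_def)
qed


section \<open>Perturbed moments\<close>

lemma foldr_mult_carrier:
  assumes "\<And>i. i \<in> set u \<Longrightarrow> C i \<in> carrier_mat k k" "Z \<in> carrier_mat k k"
  shows "foldr (*) (map C u) Z \<in> carrier_mat k k"
  using assms
proof (induction u)
  case (Cons i u)
  then show ?case using mult_carrier_mat[of "C i" k k "foldr (*) (map C u) Z" k] by simp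
qed simp

lemma foldr_mult_add_smult:
  fixes C :: "'i \<Rightarrow> complex mat"
  assumes "\<And>i. i \<in> set u \<Longrightarrow> C i \<in> carrier_mat k k" "Y \<in> carrier_mat k k" "Z \<in> carrier_mat k k"
  shows "foldr (*) (map C u) (Y + c \<cdot>\<^sub>m Z) = foldr (*) (map C u) Y + c \<cdot>\<^sub>m foldr (*) (map C u) Z"
  using assms(1)
proof (induction u)
  case (Cons i u)
  have Y: "foldr (*) (map C u) Y \<in> carrier_mat k k" and Z: "foldr (*) (map C u) Z \<in> carrier_mat k k"
    using Cons.prems assms(2,3) by (auto intro!: foldr_mult_carrier)
  have C: "C i \<in> carrier_mat k k" using Cons.prems by simp
  show ?case
    using Cons mult_add_distrib_mat[OF C Y smult_carrier_mat[OF Z]] mult_smult_distrib[OF C Z] by simp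
qed simp

lemma ntr_add_smult:
  assumes "Y \<in> carrier_mat k k" "Z \<in> carrier_mat k k"
  shows "ntr (Y + c \<cdot>\<^sub>m Z) = ntr Y + c * ntr Z"
  using assms by (auto simp: ntr_def sum.distrib sum_distrib_left add_divide_distrib)

text \<open>Links the complex homogeneity of a trace with the real scaling in x + \<epsilon>
  s.\<close>

lemma scale_op_of_real: "scale_op (complex_of_real r) T = r *\<^sub>R T"
proof -
  have "(\<lambda>x. complex_of_real r *\<^sub>C blinfun_apply T x) = blinfun_apply (r *\<^sub>R T)"
    by (simp add: fun_eq_iff scaleC_of_real scaleR_blinfun.rep_eq)
  then show ?thesis unfolding scale_op_def by (simp add: blinfun_apply_inverse)
qed

lemma foldr_compose_in:
  assumes "unital_star_subalgebra N" "\<And>i. i \<in> set u \<Longrightarrow> X i \<in> N" "T \<in> N"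
  shows "foldr (o\<^sub>L) (map X u) T \<in> N"
  using assms(2,3) assms(1)[unfolded unital_star_subalgebra_def]
  by (induction u) auto

lemma foldr_compose_add_scaleR:
  fixes X :: "'i \<Rightarrow> 'a::real_normed_vector \<Rightarrow>\<^sub>L 'a"
  shows "foldr (o\<^sub>L) (map X u) (S + r *\<^sub>R T) = foldr (o\<^sub>L) (map X u) S + r *\<^sub>R foldr (o\<^sub>L) (map X u) T"
  by (induction u) (simp_all add: bounded_bilinear.add_right[OF bounded_bilinear_blinfun_compose]
      bounded_bilinear.scaleR_right[OF bounded_bilinear_blinfun_compose])

lemma unital_star_subalgebra_scaleR:
  assumes "unital_star_subalgebra N" "T \<in> N"
  shows "r *\<^sub>R T \<in> N"
  using assms unfolding scale_op_of_real[symmetric] unital_star_subalgebra_def by blast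

text \<open>Expanding one perturbed letter at a time multiplies the error by \<open>1 + \<bar>r\<bar>\<close>.\<close>

lemma perturbed_moment_diff:
  fixes X Y :: "nat \<Rightarrow> complex mat" and x y :: "nat \<Rightarrow> 'g::complex_hilbert_space opr"
  assumes N: "unital_star_subalgebra N"
    and add: "\<And>S T. S \<in> N \<Longrightarrow> T \<in> N \<Longrightarrow> \<sigma> (S + T) = \<sigma> S + \<sigma> T"
    and scale: "\<And>c T. T \<in> N \<Longrightarrow> \<sigma> (scale_op c T) = c * \<sigma> T"
    and X: "\<And>i. i < n + n \<Longrightarrow> X i \<in> carrier_mat k k" and x: "\<And>i. i < n + n \<Longrightarrow> x i \<in> N"
    and Y: "\<And>i. i < n \<Longrightarrow> Y i = X i + complex_of_real r \<cdot>\<^sub>m X (n + i)"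
    and y: "\<And>i. i < n \<Longrightarrow> y i = x i + r *\<^sub>R x (n + i)"
    and close: "\<And>w. 1 \<le> length w \<Longrightarrow> length w \<le> m \<Longrightarrow> set w \<subseteq> {..<n + n} \<Longrightarrow>
      cmod (ntr (foldr (*) (map X w) (1\<^sub>m k)) - \<sigma> (op_prod (map x w))) \<le> \<delta>"
    and w: "1 \<le> length u + length v" "length u + length v \<le> m" "set u \<subseteq> {..<n + n}" "set v \<subseteq> {..<n}"
  shows "cmod (ntr (foldr (*) (map X u) (foldr (*) (map Y v) (1\<^sub>m k)))
    - \<sigma> (foldr (o\<^sub>L) (map x u) (op_prod (map y v)))) \<le> (1 + \<bar>r\<bar>) ^ length v * \<delta>"
  using w
\<comment> \<open>u collects the letters already expanded, v the perturbed ones still to come. The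
  induction generalises over u because an expanded letter moves to the end of u.\<close>
proof (induction v arbitrary: u)
  case Nil
  have "foldr (o\<^sub>L) (map x u) id_blinfun = op_prod (map x u)" by (simp add: op_prod_def)
  then show ?case using Nil close[of u] by (simp add: op_prod_def)
next
  case (Cons j v)
  define P where "P = foldr (*) (map Y v) (1\<^sub>m k)"
  define p where "p = op_prod (map y v)"
  have j: "j < n" "n + j < n + n" using Cons.prems by auto
  have Xj: "X j \<in> carrier_mat k k" "X (n + j) \<in> carrier_mat k k" using X j by auto
  have P: "P \<in> carrier_mat k k"
    unfolding P_def
  proof (rule foldr_mult_carrier)
    fix i assume "i \<in> set v"
    then have "i < n" using Cons.prems by auto
    then show "Y i \<in> carrier_mat k k" using Y X[of i] X[of "n + i"] by auto
  qed simp
  have id: "id_blinfun \<in> N" using N by (simp add: unital_star_subalgebra_def)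
  have p: "p \<in> N"
    unfolding p_def op_prod_def
  proof (rule foldr_compose_in[OF N _ id])
    fix i assume "i \<in> set v"
    then have "i < n" using Cons.prems by auto
    then show "y i \<in> N" using y x[of i] x[of "n + i"] unital_star_subalgebra_scaleR[OF N] N
      by (auto simp: unital_star_subalgebra_def)
  qed
  have XP: "X j * P \<in> carrier_mat k k" "X (n + j) * P \<in> carrier_mat k k" using Xj P by auto
  have xp: "x j o\<^sub>L p \<in> N" "x (n + j) o\<^sub>L p \<in> N"
    using x j p N by (auto simp: unital_star_subalgebra_def)
  have u: "i < n + n" if "i \<in> set u" for i using Cons.prems that by auto
  let ?M = "\<lambda>Z. foldr (*) (map X u) Z" and ?S = "\<lambda>Z. foldr (o\<^sub>L) (map x u) Z"
  have "Y j * P = X j * P + complex_of_real r \<cdot>\<^sub>m (X (n + j) * P)"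
    unfolding Y[OF j(1)] using add_mult_distrib_mat[OF Xj(1) smult_carrier_mat[OF Xj(2)] P]
      mult_smult_assoc_mat[OF Xj(2) P] by simp
  then have 1: "ntr (?M (Y j * P)) = ntr (?M (X j * P)) + complex_of_real r * ntr (?M (X (n + j) * P))"
    using foldr_mult_add_smult[of u X k, OF X[OF u] XP] 
      ntr_add_smult[OF foldr_mult_carrier[of u X k, OF X[OF u] XP(1)] foldr_mult_carrier[of u X k, OF X[OF u] XP(2)]]
    by simp
  have "y j o\<^sub>L p = (x j o\<^sub>L p) + r *\<^sub>R (x (n + j) o\<^sub>L p)"
    unfolding y[OF j(1)] by (simp add: bounded_bilinear.add_left[OF bounded_bilinear_blinfun_compose]
      bounded_bilinear.scaleR_left[OF bounded_bilinear_blinfun_compose])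
  then have "\<sigma> (?S (y j o\<^sub>L p)) = \<sigma> (?S (x j o\<^sub>L p) + r *\<^sub>R ?S (x (n + j) o\<^sub>L p))"
    by (simp add: foldr_compose_add_scaleR)
  also have "\<dots> = \<sigma> (?S (x j o\<^sub>L p)) + complex_of_real r * \<sigma> (?S (x (n + j) o\<^sub>L p))"
  proof -
    have S: "?S T \<in> N" if "T \<in> N" for T
      by (rule foldr_compose_in[OF N _ that]) (use x u in auto)
    show ?thesis
      using add[OF S[OF xp(1)] unital_star_subalgebra_scaleR[OF N S[OF xp(2)], of r]]
        scale[OF S[OF xp(2)], of "complex_of_real r"] by (simp add: scale_op_of_real)
  qed
  finally have 2: "\<sigma> (?S (y j o\<^sub>L p)) = \<sigma> (?S (x j o\<^sub>L p)) + complex_of_real r * \<sigma> (?S (x (n + j) o\<^sub>L p))" .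
  have IH: "cmod (ntr (?M (X i * P)) - \<sigma> (?S (x i o\<^sub>L p))) \<le> (1 + \<bar>r\<bar>) ^ length v * \<delta>" if "i < n + n" for i
    using Cons.IH[of "u @ [i]"] Cons.prems that by (simp add: P_def p_def)
  have "ntr (?M (Y j * P)) - \<sigma> (?S (y j o\<^sub>L p))
     = (ntr (?M (X j * P)) - \<sigma> (?S (x j o\<^sub>L p)))
      + complex_of_real r * (ntr (?M (X (n + j) * P)) - \<sigma> (?S (x (n + j) o\<^sub>L p)))"
    unfolding 1 2 by (simp add: algebra_simps)
  moreover have tri: "cmod (a + complex_of_real r * b) \<le> cmod a + \<bar>r\<bar> * cmod b" for a b
    using norm_triangle_ineq[of a "complex_of_real r * b"] by (simp add: norm_mult)
  ultimately have "cmod (ntr (?M (Y j * P)) - \<sigma> (?S (y j o\<^sub>L p)))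
     \<le> cmod (ntr (?M (X j * P)) - \<sigma> (?S (x j o\<^sub>L p)))
      + \<bar>r\<bar> * cmod (ntr (?M (X (n + j) * P)) - \<sigma> (?S (x (n + j) o\<^sub>L p)))"
    by (simp only: tri)
  also have "\<dots> \<le> (1 + \<bar>r\<bar>) ^ length v * \<delta> + \<bar>r\<bar> * ((1 + \<bar>r\<bar>) ^ length v * \<delta>)"
    using j by (intro add_mono mult_left_mono IH) auto
  also have "\<dots> = (1 + \<bar>r\<bar>) ^ length (j # v) * \<delta>" by (simp add: algebra_simps)
  finally show ?case by (simp add: P_def p_def op_prod_def)
qed

text \<open>Stars disappear on self-adjoint tuples, so the *-moments tested by
  \<open>microstates\<close> reduce to ordinary moments, the kind that \<open>sa_microstates\<close>
  controls.\<close>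

lemma mat_word_selfadjoint:
  assumes "\<And>A. A \<in> set As \<Longrightarrow> mat_adjoint A = A" "fst ` set w \<subseteq> {..<length As}"
  shows "mat_word k As w = foldr (*) (map ((!) As) (map fst w)) (1\<^sub>m k)"
  using assms by (induction w) (auto simp: mat_word_def)

lemma op_word_selfadjoint:
  assumes "\<forall>x\<in>set xs. selfadjoint x" "fst ` set w \<subseteq> {..<length xs}"
  shows "op_word xs w = op_prod (map ((!) xs) (map fst w))"
  using assms by (induction w) (auto simp: op_word_def op_prod_def)

text \<open>Lets the moments of \<open>xs\<close> be computed in N, where they can be compared with
  those of the perturbed elements.\<close>

lemma embedding_op_prod:
  assumes "trace_preserving_embedding M \<tau> N \<sigma> \<pi>" "unital_star_subalgebra M" "set ts \<subseteq> M"
  shows "op_prod ts \<in> M \<and> \<pi> (op_prod ts) = op_prod (map \<pi> ts)"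
  using assms(3)
proof (induction ts)
  case Nil
  then show ?case using assms(1,2)
    by (simp add: op_prod_def trace_preserving_embedding_def unital_star_subalgebra_def)
next
  case (Cons t ts)
  then show ?case using assms(1,2)
    by (auto simp: op_prod_def trace_preserving_embedding_def unital_star_subalgebra_def)
qed

text \<open>The square of \<open>frob C\<close> divided by k is the normalised trace of C^2, which
  is within 1 of a prescribed number; so the bound does not see the cutoff R.\<close>

lemma tuple_frob_le_moments:
  assumes k: "0 < k" and Cs: "Cs \<in> mat_tuples n k" and sa: "\<And>C. C \<in> set Cs \<Longrightarrow> mat_adjoint C = C"
    and z: "\<And>l. l < n \<Longrightarrow> cmod (ntr (Cs ! l * Cs ! l) - z l) \<le> 1"
  shows "tuple_frob Cs \<le> sqrt (\<Sum>l<n. cmod (z l) + 1) * sqrt k"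
proof -
  have len: "length Cs = n" using Cs by (rule mat_tuples_length)
  have "(frob (Cs ! l))\<^sup>2 \<le> (cmod (z l) + 1) * k" if l: "l < n" for l
  proof -
    have "(frob (Cs ! l))\<^sup>2 / k = Re (ntr (Cs ! l * Cs ! l))"
      using ntr_adjoint_mult[OF mat_tuples_nth[OF Cs l]] sa[of "Cs ! l"] l len by simp
    also have "\<dots> \<le> cmod (ntr (Cs ! l * Cs ! l))" by (rule complex_Re_le_cmod)
    also have "\<dots> \<le> cmod (z l) + 1"
      using z[OF l] norm_triangle_sub[of "ntr (Cs ! l * Cs ! l)" "z l"] by linarith
    finally show ?thesis using k by (simp add: divide_le_eq)
  qed
  then have "(tuple_frob Cs)\<^sup>2 \<le> (\<Sum>l<n. (cmod (z l) + 1) * k)"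
    unfolding tuple_frob_def L2_set_power2 len by (intro sum_mono) simp
  then have "(tuple_frob Cs)\<^sup>2 \<le> (\<Sum>l<n. cmod (z l) + 1) * k"
    by (simp only: sum_distrib_right)
  then show ?thesis
    using real_le_rsqrt by (simp add: real_sqrt_mult[symmetric])
qed

lemma tuple_dist_scaled:
  assumes "\<epsilon> > 0" "As \<in> mat_tuples n k" "Bs \<in> mat_tuples n k"
    and Cs: "\<And>l. l < n \<Longrightarrow> Cs ! l = As ! l + complex_of_real (- \<epsilon>) \<cdot>\<^sub>m Bs ! l"
  shows "tuple_dist As Cs = \<epsilon> * tuple_frob Bs"
proof -
  have "frob (As ! l - Cs ! l) = \<epsilon> * frob (Bs ! l)" if l: "l < n" for l
    unfolding frob_def L2_set_right_distrib[OF less_imp_le[OF assms(1)]] Cs[OF l]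
    using mat_tuples_nth[OF assms(2) l] mat_tuples_nth[OF assms(3) l] assms(1)
    by (intro L2_set_cong) (auto simp: norm_mult)
  then show ?thesis
    unfolding tuple_dist_def tuple_frob_def using assms
    by (auto simp: mat_tuples_length L2_set_right_distrib intro!: L2_set_cong)
qed

lemma blinfun_compose_id_right: "f o\<^sub>L id_blinfun = f"
  by (rule blinfun_eqI) simp

text \<open>The witness is A - \<epsilon> B. Its operator norm is at most R + \<epsilon> R, hence
  the cutoff 2 R; its moments are off by at most 2^m0 \<delta>, which dictates \<delta>0 / 2^(m0 +
  1). The terms \<open>max m0 2\<close> and 1/4 make second moments available with error at most 1
  even for small m0. The constant c comes from second moments in N and is the same for all
  \<epsilon>, R and k.\<close>

lemma sa_microstates_near_microstates:
  fixes \<tau> :: "'h::complex_hilbert_space opr \<Rightarrow> complex" and \<sigma> :: "'g::complex_hilbert_space opr \<Rightarrow> complex"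
  assumes M: "unital_star_subalgebra M" and xs: "set xs \<subseteq> M" "\<forall>x\<in>set xs. selfadjoint x"
    and N: "unital_star_subalgebra N"
    and add: "\<And>S T. S \<in> N \<Longrightarrow> T \<in> N \<Longrightarrow> \<sigma> (S + T) = \<sigma> S + \<sigma> T"
    and scale: "\<And>c T. T \<in> N \<Longrightarrow> \<sigma> (scale_op c T) = c * \<sigma> T"
    and emb: "trace_preserving_embedding M \<tau> N \<sigma> \<pi>"
    and len: "length ss = length xs" and ss: "set ss \<subseteq> N"
    and \<epsilon>: "0 < \<epsilon>" "\<epsilon> < 1" and \<delta>0: "0 < \<delta>0" and R: "0 < R" and k: "0 < k"
    and c: "c = sqrt (\<Sum>l<length xs. cmod (\<sigma> (ss ! l o\<^sub>L ss ! l)) + 1) +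
      sqrt (\<Sum>l<length xs. cmod (\<sigma> (\<pi> (xs ! l) o\<^sub>L \<pi> (xs ! l))) + 1)"
    and As: "As \<in> sa_microstates \<sigma> (map2 (\<lambda>x s. x + \<epsilon> *\<^sub>R s) (map \<pi> xs) ss) ss R (max m0 2) k
      (min (1 / 4) (\<delta>0 / 2 ^ (m0 + 1)))"
  shows "\<exists>Bs\<in>microstates \<tau> xs (2 * R) m0 k \<delta>0.
    tuple_dist As Bs \<le> c * \<epsilon> * sqrt k \<and> tuple_frob Bs \<le> c * sqrt k"
proof -
  define n where "n = length xs"
  define \<delta> where "\<delta> = min (1 / 4) (\<delta>0 / 2 ^ (m0 + 1))"
  define ys where "ys = map2 (\<lambda>x s. x + \<epsilon> *\<^sub>R s) (map \<pi> xs) ss"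
  have \<delta>: "\<delta> > 0" "\<delta> \<le> 1 / 4" "2 ^ m0 * \<delta> < \<delta>0"
  proof -
    show "\<delta> > 0" "\<delta> \<le> 1 / 4" using \<delta>0 by (auto simp: \<delta>_def)
    have "2 ^ m0 * \<delta> \<le> 2 ^ m0 * (\<delta>0 / 2 ^ (m0 + 1))" unfolding \<delta>_def by (intro mult_left_mono) auto
    also have "\<dots> < \<delta>0" using \<delta>0 by simp
    finally show "2 ^ m0 * \<delta> < \<delta>0" .
  qed
  have lens: "length ys = n" "length ss = n" "length xs = n" using len by (auto simp: ys_def n_def)
  obtain Bs where Asn: "As \<in> mat_tuples n k" and Bsn: "Bs \<in> mat_tuples n k"
    and sa: "\<And>A. A \<in> set (As @ Bs) \<Longrightarrow> mat_adjoint A = A \<and> mat_op_norm A \<le> R"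
    and close: "\<And>w. 1 \<le> length w \<Longrightarrow> length w \<le> max m0 2 \<Longrightarrow> set w \<subseteq> {..<n + n} \<Longrightarrow>
        cmod (ntr (foldr (*) (map ((!) (As @ Bs)) w) (1\<^sub>m k)) - \<sigma> (op_prod (map ((!) (ys @ ss)) w))) \<le> \<delta>"
  proof -
    from As obtain Bs where *: "As \<in> mat_tuples n k" "Bs \<in> mat_tuples n k"
      "\<forall>A\<in>set (As @ Bs). mat_adjoint A = A \<and> mat_op_norm A \<le> R"
      "\<forall>w. 1 \<le> length w \<longrightarrow> length w \<le> max m0 2 \<longrightarrow> set w \<subseteq> {..<length (ys @ ss)} \<longrightarrow>
           cmod (ntr (foldr (*) (map ((!) (As @ Bs)) w) (1\<^sub>m k)) - \<sigma> (op_prod (map ((!) (ys @ ss)) w))) < \<delta>"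
      unfolding sa_microstates_def \<delta>_def[symmetric] ys_def[symmetric] lens by blast
    show thesis
      by (rule that[OF *(1,2)]) (use *(3,4) lens in \<open>auto intro!: less_imp_le\<close>)
  qed
  have lenA: "length As = n" "length Bs = n" using Asn Bsn by (auto simp: mat_tuples_length)
  define Cs where "Cs = map2 (\<lambda>A B. A + complex_of_real (- \<epsilon>) \<cdot>\<^sub>m B) As Bs"
  have Cs_nth: "Cs ! l = As ! l + complex_of_real (- \<epsilon>) \<cdot>\<^sub>m Bs ! l" if "l < n" for l
    using that lenA by (simp add: Cs_def)
  have lenC: "length Cs = n" using lenA by (simp add: Cs_def)
  have car: "As ! l \<in> carrier_mat k k" "Bs ! l \<in> carrier_mat k k" if "l < n" for l
    using mat_tuples_nth[OF Asn that] mat_tuples_nth[OF Bsn that] .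
  have saA: "mat_adjoint (As ! l) = As ! l" "mat_adjoint (Bs ! l) = Bs ! l"
    "mat_op_norm (As ! l) \<le> R" "mat_op_norm (Bs ! l) \<le> R" if "l < n" for l
    using sa that lenA by auto
  have Cn: "Cs ! l \<in> carrier_mat k k" "mat_adjoint (Cs ! l) = Cs ! l" "mat_op_norm (Cs ! l) \<le> 2 * R" if l: "l < n" for l
  proof -
    show "Cs ! l \<in> carrier_mat k k" using Cs_nth[OF l] car[OF l] by simp
    have "mat_adjoint (Cs ! l) = mat_adjoint (As ! l) + complex_of_real (- \<epsilon>) \<cdot>\<^sub>m mat_adjoint (Bs ! l)"
      unfolding Cs_nth[OF l] by (rule eq_matI) (use car[OF l] in auto)
    then show "mat_adjoint (Cs ! l) = Cs ! l" using Cs_nth[OF l] saA[OF l] by simp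
    have "mat_op_norm (Cs ! l) \<le> mat_op_norm (As ! l) + mat_op_norm (complex_of_real (- \<epsilon>) \<cdot>\<^sub>m Bs ! l)"
      unfolding Cs_nth[OF l] by (rule mat_op_norm_triangle[of _ k k]) (use car[OF l] in auto)
    moreover have "mat_op_norm (complex_of_real (- \<epsilon>) \<cdot>\<^sub>m Bs ! l) \<le> \<epsilon> * mat_op_norm (Bs ! l)"
      using mat_op_norm_smult[of "complex_of_real (- \<epsilon>)" "Bs ! l"] \<epsilon> by simp
    moreover have "\<epsilon> * mat_op_norm (Bs ! l) \<le> 1 * R"
      using \<epsilon> saA[OF l] by (intro mult_mono) auto
    ultimately show "mat_op_norm (Cs ! l) \<le> 2 * R" using saA[OF l] by linarith
  qed
  have Csn: "Cs \<in> mat_tuples n k"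
    using Cn(1) lenC by (auto simp: mat_tuples_def in_set_conv_nth)
  have saC: "mat_adjoint C = C" "mat_op_norm C \<le> 2 * R" if "C \<in> set Cs" for C
    using that Cn(2,3) lenC by (auto simp: in_set_conv_nth)
  have \<pi>N: "\<pi> x \<in> N" if "x \<in> M" for x using emb that by (auto simp: trace_preserving_embedding_def)
  \<comment> \<open>Stated up to length \<open>max m0 2\<close> because words of length 2, with
    error 2^2 \<delta> \<le> 1, later bound \<open>tuple_frob Cs\<close>.\<close>
  have diff: "cmod (ntr (foldr (*) (map ((!) Cs) v) (1\<^sub>m k)) - \<sigma> (op_prod (map ((!) (map \<pi> xs)) v)))
      \<le> 2 ^ length v * \<delta>" if v: "1 \<le> length v" "length v \<le> max m0 2" "set v \<subseteq> {..<n}" for v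
  proof -
    have X: "(As @ Bs) ! i \<in> carrier_mat k k" if "i < n + n" for i
      using that car[of i] car[of "i - n"] lenA by (auto simp: nth_append)
    have ysN: "ys ! i \<in> N" if "i < n" for i
    proof -
      have "xs ! i \<in> M" "ss ! i \<in> N" using that xs(1) ss lens by (auto simp: subset_iff)
      then show ?thesis
        using that lens \<pi>N unital_star_subalgebra_scaleR[OF N] N by (auto simp: ys_def unital_star_subalgebra_def)
    qed
    have x: "(ys @ ss) ! i \<in> N" if "i < n + n" for i
      using that ysN[of i] ss lens by (auto simp: nth_append subset_iff)
    have Y: "Cs ! i = (As @ Bs) ! i + complex_of_real (- \<epsilon>) \<cdot>\<^sub>m (As @ Bs) ! (n + i)" if "i < n" for i
      using Cs_nth[OF that] that lenA by (simp add: nth_append)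
    have y: "map \<pi> xs ! i = (ys @ ss) ! i + (- \<epsilon>) *\<^sub>R (ys @ ss) ! (n + i)" if "i < n" for i
      using that lens by (simp add: nth_append ys_def)
    \<comment> \<open>The unperturbed element is recovered as (x + \<epsilon> s) - \<epsilon> s, so
      the expansion is used with r = -\<epsilon> and with an empty prefix u.\<close>
    have "cmod (ntr (foldr (*) (map ((!) (As @ Bs)) []) (foldr (*) (map ((!) Cs) v) (1\<^sub>m k)))
      - \<sigma> (foldr (o\<^sub>L) (map ((!) (ys @ ss)) []) (op_prod (map ((!) (map \<pi> xs)) v)))) \<le> (1 + \<bar>- \<epsilon>\<bar>) ^ length v * \<delta>"
      by (rule perturbed_moment_diff[where n = n and m = "max m0 2", OF N add scale X x Y y close])
        (use v in auto)
    also have "\<dots> \<le> 2 ^ length v * \<delta>"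
      using \<epsilon> \<delta> by (intro mult_right_mono power_mono) auto
    finally show ?thesis by simp
  qed
  have "Cs \<in> microstates \<tau> xs (2 * R) m0 k \<delta>0"
    unfolding microstates_def
  proof (intro CollectI conjI ballI allI impI)
    show "Cs \<in> mat_tuples (length xs) k" using Csn lens by simp
    show "mat_op_norm C \<le> 2 * R" if "C \<in> set Cs" for C by (rule saC(2)[OF that])
    fix w :: "(nat \<times> bool) list"
    assume w: "1 \<le> length w" "length w \<le> m0" "fst ` set w \<subseteq> {..<length xs}"
    define v where "v = map fst w"
    have v: "1 \<le> length v" "length v \<le> m0" "set v \<subseteq> {..<n}" using w lens by (auto simp: v_def)
    have mw: "mat_word k Cs w = foldr (*) (map ((!) Cs) v) (1\<^sub>m k)"
      unfolding v_def using w lenC lens saC(1) by (intro mat_word_selfadjoint) auto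
    have ow: "op_word xs w = op_prod (map ((!) xs) v)"
      unfolding v_def by (rule op_word_selfadjoint[OF xs(2) w(3)])
    have "set (map ((!) xs) v) \<subseteq> M" using v xs(1) lens by (auto simp: subset_iff)
    then have "op_prod (map ((!) xs) v) \<in> M" "\<pi> (op_prod (map ((!) xs) v)) = op_prod (map \<pi> (map ((!) xs) v))"
      using embedding_op_prod[OF emb M] by auto
    then have "\<tau> (op_word xs w) = \<sigma> (op_prod (map \<pi> (map ((!) xs) v)))"
      using emb ow by (metis trace_preserving_embedding_def)
    also have "map \<pi> (map ((!) xs) v) = map ((!) (map \<pi> xs)) v"
      using v lens by (auto simp: subset_iff)
    finally have "cmod (ntr (mat_word k Cs w) - \<tau> (op_word xs w)) \<le> 2 ^ length v * \<delta>"
      using diff[of v] v by (simp add: mw)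
    also have "\<dots> \<le> 2 ^ m0 * \<delta>" using v \<delta> by (intro mult_right_mono power_increasing) auto
    also have "\<dots> < \<delta>0" by (rule \<delta>)
    finally show "cmod (ntr (mat_word k Cs w) - \<tau> (op_word xs w)) < \<delta>0" .
  qed
  moreover have "tuple_frob Bs \<le> sqrt (\<Sum>l<n. cmod (\<sigma> (ss ! l o\<^sub>L ss ! l)) + 1) * sqrt k"
  proof (rule tuple_frob_le_moments[OF k Bsn])
    show "mat_adjoint B = B" if "B \<in> set Bs" for B using sa that by simp
    fix l assume l: "l < n"
    have "ntr (foldr (*) (map ((!) (As @ Bs)) [n + l, n + l]) (1\<^sub>m k)) = ntr (Bs ! l * Bs ! l)"
      using lenA car[OF l] by (simp add: nth_append)
    moreover have "op_prod (map ((!) (ys @ ss)) [n + l, n + l]) = ss ! l o\<^sub>L ss ! l"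
      using lens by (simp add: op_prod_def nth_append blinfun_compose_id_right)
    ultimately show "cmod (ntr (Bs ! l * Bs ! l) - \<sigma> (ss ! l o\<^sub>L ss ! l)) \<le> 1"
      using close[of "[n + l, n + l]"] l \<delta>(2) by (simp add: le_max_iff_disj)
  qed
  moreover have "tuple_frob Cs \<le> sqrt (\<Sum>l<n. cmod (\<sigma> (\<pi> (xs ! l) o\<^sub>L \<pi> (xs ! l))) + 1) * sqrt k"
  proof (rule tuple_frob_le_moments[OF k Csn saC(1)])
    fix l assume l: "l < n"
    have "ntr (foldr (*) (map ((!) Cs) [l, l]) (1\<^sub>m k)) = ntr (Cs ! l * Cs ! l)"
      using Cn(1)[OF l] by simp
    moreover have "op_prod (map ((!) (map \<pi> xs)) [l, l]) = \<pi> (xs ! l) o\<^sub>L \<pi> (xs ! l)"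
      using l lens by (simp add: op_prod_def blinfun_compose_id_right)
    ultimately show "cmod (ntr (Cs ! l * Cs ! l) - \<sigma> (\<pi> (xs ! l) o\<^sub>L \<pi> (xs ! l))) \<le> 1"
      using diff[of "[l, l]"] l \<delta>(2) by (simp add: le_max_iff_disj)
  qed
  moreover have "tuple_dist As Cs = \<epsilon> * tuple_frob Bs"
    by (rule tuple_dist_scaled[OF \<epsilon>(1) Asn Bsn Cs_nth])
  moreover have "sqrt (\<Sum>l<n. cmod (\<sigma> (ss ! l o\<^sub>L ss ! l)) + 1) * sqrt k \<le> c * sqrt k"
    "sqrt (\<Sum>l<n. cmod (\<sigma> (\<pi> (xs ! l) o\<^sub>L \<pi> (xs ! l))) + 1) * sqrt k \<le> c * sqrt k"
    unfolding c n_def by (intro mult_right_mono; simp add: sum_nonneg)+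
  ultimately have "Cs \<in> microstates \<tau> xs (2 * R) m0 k \<delta>0" "tuple_frob Cs \<le> c * sqrt k"
     "tuple_dist As Cs \<le> \<epsilon> * (c * sqrt k)"
    using mult_left_mono[of "tuple_frob Bs" "c * sqrt k" \<epsilon>] \<epsilon> by linarith+
  then show ?thesis by (intro bexI[of _ Cs]) (auto simp: mult_ac)
qed

text \<open>Each q may choose its own p. As L > 0, the affine map can be inverted, which turns the
  claim into a lower bound for the infimum over B, to be checked term by term.\<close>

lemma INF_le_affine_INF:
  fixes f :: "'a \<Rightarrow> ereal" and g :: "'b \<Rightarrow> ereal" and L C :: real
  assumes L: "0 < L" and "\<And>q. q \<in> B \<Longrightarrow> \<exists>p\<in>A. f p \<le> ereal L * g q + ereal C"
  shows "(INF p\<in>A. f p) \<le> ereal L * (INF q\<in>B. g q) + ereal C"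
proof -
  have "((INF p\<in>A. f p) - ereal C) / ereal L \<le> (INF q\<in>B. g q)"
  proof (rule INF_greatest)
    fix q assume "q \<in> B"
    then obtain p where "p \<in> A" "f p \<le> ereal L * g q + ereal C" using assms(2) by blast
    then have "(INF p\<in>A. f p) \<le> ereal L * g q + ereal C" by (meson INF_lower order_trans)
    then show "((INF p\<in>A. f p) - ereal C) / ereal L \<le> g q"
      using L by (simp add: ereal_divide_le_pos ereal_minus_le)
  qed
  then show ?thesis using L by (simp add: ereal_divide_le_pos ereal_minus_le)
qed

text \<open>C is chosen before \<epsilon> and serves every cutoff R, so it vanishes after division
  by |ln \<epsilon>| in the limit. The passage from R to 2 R is absorbed by the supremum over
  cutoffs on the right.\<close>

lemma free_entropy_le_orbit_dim_at:
  fixes \<tau> :: "'h::complex_hilbert_space opr \<Rightarrow> complex" and \<sigma> :: "'g::complex_hilbert_space opr \<Rightarrow> complex"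
  assumes M: "unital_star_subalgebra M" and xs: "set xs \<subseteq> M" "\<forall>x\<in>set xs. selfadjoint x" "xs \<noteq> []"
    and N: "unital_star_subalgebra N"
    and add: "\<And>S T. S \<in> N \<Longrightarrow> T \<in> N \<Longrightarrow> \<sigma> (S + T) = \<sigma> S + \<sigma> T"
    and scale: "\<And>c T. T \<in> N \<Longrightarrow> \<sigma> (scale_op c T) = c * \<sigma> T"
    and emb: "trace_preserving_embedding M \<tau> N \<sigma> \<pi>"
    and len: "length ss = length xs" and ss: "set ss \<subseteq> N"
  shows "\<exists>C. \<forall>\<epsilon>. 0 < \<epsilon> \<longrightarrow> \<epsilon> < 1 \<longrightarrow>
    free_entropy \<sigma> (map2 (\<lambda>x s. x + \<epsilon> *\<^sub>R s) (map \<pi> xs) ss) ss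
      \<le> ereal (- ln \<epsilon>) * orbit_dim_at \<tau> xs \<epsilon> + ereal (C + (1 - real (length xs)) * - ln \<epsilon>)"
proof -
  define n where "n = length xs"
  have n: "0 < n" using xs by (simp add: n_def)
  define c where "c = sqrt (\<Sum>l<length xs. cmod (\<sigma> (ss ! l o\<^sub>L ss ! l)) + 1) +
      sqrt (\<Sum>l<length xs. cmod (\<sigma> (\<pi> (xs ! l) o\<^sub>L \<pi> (xs ! l))) + 1)"
  have c: "0 \<le> c" unfolding c_def by (intro add_nonneg_nonneg real_sqrt_ge_zero sum_nonneg) auto
  define C where "C = ln 243 + real n / 2 * ln (200 * pi * exp 1 * (c + 1)\<^sup>2 / n)"
  have "free_entropy \<sigma> (map2 (\<lambda>x s. x + \<epsilon> *\<^sub>R s) (map \<pi> xs) ss) ss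
      \<le> ereal (- ln \<epsilon>) * orbit_dim_at \<tau> xs \<epsilon> + ereal (C + (1 - real n) * - ln \<epsilon>)"
    if \<epsilon>: "0 < \<epsilon>" "\<epsilon> < 1" for \<epsilon>
  proof -
    define ys where "ys = map2 (\<lambda>x s. x + \<epsilon> *\<^sub>R s) (map \<pi> xs) ss"
    have ys: "length ys = n" using len by (simp add: ys_def n_def)
    have L: "0 < - ln \<epsilon>" using \<epsilon> by simp
    define C1 where "C1 = C + (1 - real n) * - ln \<epsilon>"
    have "free_entropy \<sigma> ys ss \<le> ereal (- ln \<epsilon>) * orbit_dim_at \<tau> xs \<epsilon> + ereal C1"
      unfolding free_entropy_def ys
    proof (rule SUP_least)
      fix R :: real assume "R \<in> {0<..}"
      then have R: "0 < R" by simp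
      let ?f = "\<lambda>m \<delta> k. eln (sa_volume n k (sa_microstates \<sigma> ys ss R m k \<delta>)) / ereal ((real k)\<^sup>2)
        + ereal (real n / 2 * ln (real k))"
      let ?g = "\<lambda>m \<delta> k. eln (orbit_covering_number k (microstates \<tau> xs (2 * R) m k \<delta>) \<epsilon>) / ereal (- (real k)\<^sup>2 * ln \<epsilon>)"
      have "(INF (m, \<delta>)\<in>UNIV \<times> {0<..}. limsup (?f m \<delta>))
         \<le> ereal (- ln \<epsilon>) * (INF (m, \<delta>)\<in>UNIV \<times> {0<..}. limsup (?g m \<delta>)) + ereal C1"
      proof (rule INF_le_affine_INF[OF L])
        fix q :: "nat \<times> real" assume "q \<in> UNIV \<times> {0<..}"
        then obtain m0 \<delta>0 where q: "q = (m0, \<delta>0)" and \<delta>0: "0 < \<delta>0" by auto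
        define m where "m = max m0 2"
        define \<delta> where "\<delta> = min (1 / 4) (\<delta>0 / 2 ^ (m0 + 1))"
        have "\<delta> > 0" using \<delta>0 by (simp add: \<delta>_def)
        have "?f m \<delta> k \<le> ereal (- ln \<epsilon>) * ?g m0 \<delta>0 k + ereal C1" if k: "0 < k" for k
          unfolding C1_def C_def
        proof (rule eln_sa_volume_le[OF n k \<epsilon> c])
          show "microstates \<tau> xs (2 * R) m0 k \<delta>0 \<subseteq> mat_tuples n k"
            by (auto simp: microstates_def n_def)
          fix As assume As: "As \<in> sa_microstates \<sigma> ys ss R m k \<delta>"
          show "\<exists>Bs\<in>microstates \<tau> xs (2 * R) m0 k \<delta>0.
              tuple_dist As Bs \<le> c * \<epsilon> * sqrt k \<and> tuple_frob Bs \<le> c * sqrt k"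
            by (rule sa_microstates_near_microstates[OF M xs(1,2) N _ _ emb len ss \<epsilon> \<delta>0 R k c_def
                  As[unfolded ys_def m_def \<delta>_def]]) (auto intro: add scale)
        qed
        then have "limsup (?f m \<delta>) \<le> limsup (\<lambda>k. ereal (- ln \<epsilon>) * ?g m0 \<delta>0 k + ereal C1)"
          by (intro Limsup_mono eventually_mono[OF eventually_gt_at_top[of 0]])
        also have "\<dots> = ereal (- ln \<epsilon>) * limsup (?g m0 \<delta>0) + ereal C1"
          using L by (subst Limsup_add_ereal_right) (auto simp: limsup_ereal_mult_left simp del: uminus_ereal.simps)
        finally show "\<exists>p\<in>UNIV \<times> {0<..}. (case p of (m, \<delta>) \<Rightarrow> limsup (?f m \<delta>))
            \<le> ereal (- ln \<epsilon>) * (case q of (m, \<delta>) \<Rightarrow> limsup (?g m \<delta>)) + ereal C1"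
          unfolding q prod.case using \<open>\<delta> > 0\<close> by (intro bexI[of _ "(m, \<delta>)"]) auto
      qed
      also have "(INF (m, \<delta>)\<in>UNIV \<times> {0<..}. limsup (?g m \<delta>)) = orbit_dim_cutoff \<tau> xs \<epsilon> (2 * R)"
        by (simp only: orbit_dim_cutoff_def)
      also have "ereal (- ln \<epsilon>) * orbit_dim_cutoff \<tau> xs \<epsilon> (2 * R) + ereal C1
         \<le> ereal (- ln \<epsilon>) * orbit_dim_at \<tau> xs \<epsilon> + ereal C1"
        unfolding orbit_dim_at_def using R L
        by (intro add_right_mono ereal_mult_left_mono SUP_upper) auto
      finally show "(INF (m, \<delta>)\<in>UNIV \<times> {0<..}. limsup (?f m \<delta>))
        \<le> ereal (- ln \<epsilon>) * orbit_dim_at \<tau> xs \<epsilon> + ereal C1" .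
    qed
    then show ?thesis by (simp only: ys_def C1_def)
  qed
  then show ?thesis by (auto simp: n_def)
qed

theorem lemma1:
  fixes M :: "'h::complex_hilbert_space opr set" and \<tau> :: "'h opr \<Rightarrow> complex"
    and N :: "'g::complex_hilbert_space opr set" and \<sigma> :: "'g opr \<Rightarrow> complex"
    and \<pi> :: "'h opr \<Rightarrow> 'g opr"
    and xs :: "'h opr list" and ss :: "'g opr list"
  assumes "tracial_von_neumann_algebra M \<tau>"
    and "xs \<noteq> []" and "set xs \<subseteq> M" and "\<forall>x\<in>set xs. selfadjoint x"
    and "tracial_von_neumann_algebra N \<sigma>"
    and "trace_preserving_embedding M \<tau> N \<sigma> \<pi>"
    and "length ss = length xs" and "set ss \<subseteq> N"
    and "free_semicircular_family_free_from \<sigma> ss (map \<pi> xs)"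
  shows "free_entropy_dim \<sigma> (map \<pi> xs) ss \<le> orbit_dim1 \<tau> xs + 1 \<and>
         orbit_dim1 \<tau> xs + 1 \<le> orbit_dim2 \<tau> xs + 1"
proof
  define n where "n = length xs"
  have M: "unital_star_subalgebra M" and N: "unital_star_subalgebra N"
    using assms(1,5) by (auto simp: tracial_von_neumann_algebra_def von_neumann_algebra_def)
  have add: "\<sigma> (S + T) = \<sigma> S + \<sigma> T" if "S \<in> N" "T \<in> N" for S T
    using assms(5) that by (auto simp: tracial_von_neumann_algebra_def faithful_normal_tracial_state_def)
  have scale: "\<sigma> (scale_op c T) = c * \<sigma> T" if "T \<in> N" for T c
    using assms(5) that by (auto simp: tracial_von_neumann_algebra_def faithful_normal_tracial_state_def)
  obtain C where C: "\<And>\<epsilon>. 0 < \<epsilon> \<Longrightarrow> \<epsilon> < 1 \<Longrightarrow>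
    free_entropy \<sigma> (map2 (\<lambda>x s. x + \<epsilon> *\<^sub>R s) (map \<pi> xs) ss) ss
      \<le> ereal (- ln \<epsilon>) * orbit_dim_at \<tau> xs \<epsilon> + ereal (C + (1 - real n) * - ln \<epsilon>)"
  proof -
    have "\<exists>C. \<forall>\<epsilon>. 0 < \<epsilon> \<longrightarrow> \<epsilon> < 1 \<longrightarrow>
      free_entropy \<sigma> (map2 (\<lambda>x s. x + \<epsilon> *\<^sub>R s) (map \<pi> xs) ss) ss
        \<le> ereal (- ln \<epsilon>) * orbit_dim_at \<tau> xs \<epsilon> + ereal (C + (1 - real n) * - ln \<epsilon>)"
      unfolding n_def
      by (rule free_entropy_le_orbit_dim_at[OF M assms(3,4,2) N _ _ assms(6,7,8)]) (auto intro: add scale)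
    then show thesis using that by blast
  qed
  let ?\<chi> = "\<lambda>\<epsilon>. free_entropy \<sigma> (map2 (\<lambda>x s. x + \<epsilon> *\<^sub>R s) (map \<pi> xs) ss) ss / ereal \<bar>ln \<epsilon>\<bar>"
  show "free_entropy_dim \<sigma> (map \<pi> xs) ss \<le> orbit_dim1 \<tau> xs + 1"
  proof (rule ereal_le_epsilon2)
    fix e :: real assume e: "0 < e"
    \<comment> \<open>Below exp (-|C| / e) the constant C is at most e times -ln \<epsilon>, so it
      fits into the slack e.\<close>
    have small: "\<forall>\<^sub>F \<epsilon> in at_right (0::real). \<epsilon> < min 1 (exp (- (\<bar>C\<bar> / e)))"
      by (rule order_tendstoD(2)[OF tendsto_ident_at]) simp
    have "\<forall>\<^sub>F \<epsilon> in at_right 0. ?\<chi> \<epsilon> \<le> orbit_dim_at \<tau> xs \<epsilon> + ereal (1 - real n + e)"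
      using small eventually_at_right_less[of 0]
    proof eventually_elim
      case (elim \<epsilon>)
      then have \<epsilon>: "0 < \<epsilon>" "\<epsilon> < 1" by auto
      define L where "L = - ln \<epsilon>"
      have L: "0 < L" using \<epsilon> by (simp add: L_def)
      have "ln \<epsilon> < ln (exp (- (\<bar>C\<bar> / e)))" using elim \<epsilon> by (subst ln_less_cancel_iff) auto
      then have "C \<le> e * L" using e by (simp add: L_def field_simps)
      have "free_entropy \<sigma> (map2 (\<lambda>x s. x + \<epsilon> *\<^sub>R s) (map \<pi> xs) ss) ss
         \<le> ereal L * orbit_dim_at \<tau> xs \<epsilon> + ereal (C + (1 - real n) * L)"
        using C[OF \<epsilon>] by (simp only: L_def)
      also have "\<dots> \<le> ereal L * orbit_dim_at \<tau> xs \<epsilon> + ereal (L * (1 - real n + e))"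
        using \<open>C \<le> e * L\<close> by (intro add_left_mono) (simp add: algebra_simps)
      also have "\<dots> = ereal L * (orbit_dim_at \<tau> xs \<epsilon> + ereal (1 - real n + e))"
        using L by (cases "orbit_dim_at \<tau> xs \<epsilon>") (auto simp: algebra_simps)
      finally show ?case
        using L \<epsilon> by (simp add: ereal_divide_le_pos L_def)
    qed
    then have "Limsup (at_right 0) ?\<chi> \<le> Limsup (at_right 0) (\<lambda>\<epsilon>. orbit_dim_at \<tau> xs \<epsilon> + ereal (1 - real n + e))"
      by (rule Limsup_mono)
    also have "\<dots> = orbit_dim1 \<tau> xs + ereal (1 - real n + e)"
      unfolding orbit_dim1_def by (rule Limsup_add_ereal_right) auto
    finally have "free_entropy_dim \<sigma> (map \<pi> xs) ss \<le> ereal (real n) + (orbit_dim1 \<tau> xs + ereal (1 - real n + e))"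
      unfolding free_entropy_dim_def n_def by (simp add: add_left_mono)
    also have "\<dots> = orbit_dim1 \<tau> xs + 1 + ereal e"
      by (cases "orbit_dim1 \<tau> xs") (auto simp: one_ereal_def)
    finally show "free_entropy_dim \<sigma> (map \<pi> xs) ss \<le> orbit_dim1 \<tau> xs + 1 + ereal e" .
  qed
  \<comment> \<open>Close to 0 on the right every \<omega> lies in the interval over which
    \<open>orbit_dim2\<close> takes its supremum.\<close>
  have "\<forall>\<^sub>F \<epsilon> in at_right (0::real). \<epsilon> \<in> {0<..<1}"
    by (rule eventually_at_right_real) simp
  then have "orbit_dim1 \<tau> xs \<le> orbit_dim2 \<tau> xs"
    unfolding orbit_dim1_def orbit_dim2_def
    by (intro Limsup_bounded) (auto elim!: eventually_mono intro: SUP_upper)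
  then show "orbit_dim1 \<tau> xs + 1 \<le> orbit_dim2 \<tau> xs + 1"
    by (rule add_right_mono)
qed

end
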